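(* Let $X$ be a separable Banach space and let $\sigma$ be the Kuratowski measure of non-compactness on $X^*$. Then, for every integer $n\ge 0$, the measure of non-compactness $\sigma^{\omega^n}$ is convexifiable; that is, there exists a constant $\kappa\ge 1$ (depending on $n$) such that $\sigma^{\omega^n}(\overline{\mathrm{conv}}^*(A))\le\kappa\,\sigma^{\omega^n}(A)$ for every weak$^*$-compact subset $A$ of $X^*$.
   Context: For a weak$^*$-compact $A\subset X^*$, $\sigma(A)$ is the infimum of all $\varepsilon>0$ such that $A$ can be covered by finitely many closed balls of diameter $\varepsilon$. $\overline{\mathrm{conv}}^*$ denotes the weak$^*$-closed convex hull and $\overline{U}^*$ the weak$^*$-closure of $U$. For a map $\eta$ from the weak$^*$-compact subsets of $X^*$ to $[0,\infty)$ and $\varepsilon>0$, the fragment derivation is $[\eta]'_\varepsilon(A)=\{x^*\in A:\ \eta(A\cap\overline{U}^* )\ge\varepsilon$ for every weak$^*$-neighborhood $U$ of $x^*\}$; inductively $[\eta]^0_\varepsilon(A)=A$, $[\eta]^{k+1}_\varepsilon(A)=[\eta]'_\varepsilon([\eta]^k_\varepsilon(A))$ and $[\eta]^\omega_\varepsilon(A)=\bigcap_{k<\omega}[\eta]^k_\varepsilon(A)$. The $\omega$-iterated measure of $\eta$ is $\eta^\omega(A)=\inf\{\varepsilon>0:\ [\eta]^\omega_\varepsilon(A)=\emptyset\}$. Define $\sigma^{\omega^0}=\sigma$ and $\sigma^{\omega^{n+1}}=(\sigma^{\omega^n})^\omega$. *)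

theory Defs
  imports "HOL-Analysis.Analysis"
begin

text \<open>
  The dual \<open>X\<^sup>*\<close> of a real normed space is the type of bounded linear maps into \<open>real\<close>, with the
  operator norm. For scalar-valued maps the strong operator topology is the topology of pointwise
  convergence, that is, the weak-star topology.
\<close>

abbreviation weak_star :: "('a::real_normed_vector \<Rightarrow>\<^sub>L real) topology"
  where "weak_star \<equiv> strong_operator_topology"

definition weak_star_nhd ::
    "('a::real_normed_vector \<Rightarrow>\<^sub>L real) \<Rightarrow> ('a \<Rightarrow>\<^sub>L real) set \<Rightarrow> bool"
  where "weak_star_nhd x U \<longleftrightarrow> (\<exists>V. openin weak_star V \<and> x \<in> V \<and> V \<subseteq> U)"

text \<open>
  Measures are total real-valued functions on sets of functionals; only their values on
  weak-star-compact sets are meaningful. On those sets every \<open>Inf\<close> below is over a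
  nonempty set of positive reals when the domain is complete, because weak-star-compact sets
  are then norm bounded. A ball of diameter \<open>\<epsilon>\<close> is a ball of radius \<open>\<epsilon> / 2\<close> (also when \<open>X = {0}\<close>).
\<close>

definition kuratowski :: "('a::real_normed_vector \<Rightarrow>\<^sub>L real) set \<Rightarrow> real"
  where "kuratowski A =
    Inf {\<epsilon>. \<epsilon> > 0 \<and> (\<exists>C. finite C \<and> A \<subseteq> (\<Union>c\<in>C. cball c (\<epsilon> / 2)))}"

definition fragment_deriv ::
    "(('a::real_normed_vector \<Rightarrow>\<^sub>L real) set \<Rightarrow> real) \<Rightarrow> real
      \<Rightarrow> ('a \<Rightarrow>\<^sub>L real) set \<Rightarrow> ('a \<Rightarrow>\<^sub>L real) set"
  where "fragment_deriv \<eta> \<epsilon> A =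
    {x \<in> A. \<forall>U. weak_star_nhd x U \<longrightarrow> \<eta> (A \<inter> weak_star closure_of U) \<ge> \<epsilon>}"

definition fragment_deriv_omega ::
    "(('a::real_normed_vector \<Rightarrow>\<^sub>L real) set \<Rightarrow> real) \<Rightarrow> real
      \<Rightarrow> ('a \<Rightarrow>\<^sub>L real) set \<Rightarrow> ('a \<Rightarrow>\<^sub>L real) set"
  where "fragment_deriv_omega \<eta> \<epsilon> A = (\<Inter>k::nat. (fragment_deriv \<eta> \<epsilon> ^^ k) A)"

definition omega_measure ::
    "(('a::real_normed_vector \<Rightarrow>\<^sub>L real) set \<Rightarrow> real) \<Rightarrow> ('a \<Rightarrow>\<^sub>L real) set \<Rightarrow> real"
  where "omega_measure \<eta> A = Inf {\<epsilon>. \<epsilon> > 0 \<and> fragment_deriv_omega \<eta> \<epsilon> A = {}}"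

text \<open>\<open>kuratowski_omega n\<close> is \<open>\<sigma>\<close> with superscript \<open>\<omega>\<^sup>n\<close>.\<close>

primrec kuratowski_omega :: "nat \<Rightarrow> ('a::real_normed_vector \<Rightarrow>\<^sub>L real) set \<Rightarrow> real"
  where
    "kuratowski_omega 0 = kuratowski"
  | "kuratowski_omega (Suc n) = omega_measure (kuratowski_omega n)"

definition convexifiable :: "(('a::real_normed_vector \<Rightarrow>\<^sub>L real) set \<Rightarrow> real) \<Rightarrow> bool"
  where "convexifiable \<eta> \<longleftrightarrow>
    (\<exists>\<kappa>\<ge>1. \<forall>A. compactin weak_star A \<longrightarrow>
       \<eta> (weak_star closure_of (convex hull A)) \<le> \<kappa> * \<eta> A)"

end

theory Submission
  imports Defs
begin

text \<open>
  The constant \<open>\<kappa> = 1\<close> works for every \<open>n\<close>. Call a measure good if it is monotone,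
  takes unions to maxima, vanishes on points, satisfies \<open>\<eta> (t A + (1 - t) B) \<le> max (\<eta> A) (\<eta> B)\<close>,
  grows by at most \<open>2 r\<close> when a ball of radius \<open>r\<close> is added, and satisfies
  \<open>\<eta> (conv\<^sup>* A) \<le> \<eta> A\<close>. The measure \<open>\<sigma>\<close> is good, and goodness passes from \<open>\<eta>\<close> to \<open>\<eta>\<^sup>\<omega>\<close>.

  The sum and ball estimates pass to \<open>\<eta>\<^sup>\<omega>\<close> because the derivative of \<open>f (A \<times> B)\<close> is contained in
  \<open>f (A' \<times> B) \<union> f (A \<times> B')\<close> for continuous \<open>f\<close>. For convexity one argues by induction on the number of
  derivations that exhaust \<open>A\<close>. Let \<open>L = conv\<^sup>* A'\<close>, \<open>M = conv\<^sup>* A\<close> and \<open>K\<^sub>t = t L + (1 - t) M\<close>, so that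
  \<open>K\<^sub>0 = M\<close> and \<open>K\<^sub>1 = L\<close>. Near a point outside \<open>K\<^sub>t\<^sub>+\<^sub>d\<close>, an element of \<open>K\<^sub>t\<close> puts mass less than \<open>t + d\<close>
  on a neighbourhood of \<open>A'\<close>; so, up to a ball of radius \<open>O(d)\<close>, it lies in \<open>t L + (1 - t) C\<close> with
  \<open>\<eta> C\<close> small. Hence boundedly many derivations move \<open>K\<^sub>t\<close> into \<open>K\<^sub>t\<^sub>+\<^sub>d\<close>, and finitely many
  derivations move \<open>M\<close> into \<open>L\<close>.
\<close>

subsection \<open>The weak-star topology\<close>

lemma weak_star_topspace [simp]: "topspace weak_star = UNIV"
  by (rule strong_operator_topology_topspace)

lemma continuous_map_weak_star_eval:
  "continuous_map weak_star euclideanreal (\<lambda>x. blinfun_apply x a)"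
  by (rule strong_operator_topology_continuous_evaluation)

lemma openin_weak_star_cylinder:
  assumes "finite F"
  shows "openin weak_star {y. \<forall>a\<in>F. \<bar>blinfun_apply y a - blinfun_apply x a\<bar> < r}"
proof -
  have "openin weak_star {y. \<forall>a\<in>F. blinfun_apply y a \<in> ball (blinfun_apply x a) r}"
    using strong_operator_topology_basis[OF assms, of "\<lambda>a. ball (blinfun_apply x a) r" "\<lambda>a. a"]
    by simp
  then show ?thesis
    by (simp add: dist_real_def abs_minus_commute)
qed

lemma closedin_weak_star_cylinder:
  "closedin weak_star {y. \<forall>a\<in>F. \<bar>blinfun_apply y a - blinfun_apply x a\<bar> \<le> r}"
proof -
  have eq: "{y. \<forall>a\<in>F. \<bar>blinfun_apply y a - blinfun_apply x a\<bar> \<le> r}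
      = (\<Inter>a\<in>F. {y \<in> topspace weak_star. blinfun_apply y a \<in> cball (blinfun_apply x a) r}) \<inter> topspace weak_star"
    by (auto simp: dist_real_def abs_minus_commute)
  have "closedin weak_star {y \<in> topspace weak_star. blinfun_apply y a \<in> cball (blinfun_apply x a) r}" for a
    by (rule closedin_continuous_map_preimage[OF continuous_map_weak_star_eval]) simp
  then show ?thesis
    unfolding eq by (cases "F = {}") (auto intro!: closedin_Int closedin_INT closedin_topspace[of weak_star, simplified])
qed

text \<open>A basic open set of the product restricts finitely many coordinates only, and the least
  of the finitely many radii serves all of them.\<close>

lemma weak_star_cylinder_base:
  assumes "openin weak_star U" "x \<in> U"
  obtains F r where "finite F" "r > 0"
    "{y. \<forall>a\<in>F. \<bar>blinfun_apply y a - blinfun_apply x a\<bar> \<le> r} \<subseteq> U"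
proof -
  obtain V where V: "open V" "U = blinfun_apply -` V"
    using assms(1) unfolding strong_operator_topology_def openin_pullback_topology by auto
  have "openin (product_topology (\<lambda>i. euclideanreal) UNIV) V"
    using V(1) by (simp add: open_fun_def)
  moreover have "blinfun_apply x \<in> V"
    using assms(2) V(2) by simp
  ultimately have "\<exists>X. blinfun_apply x \<in> Pi\<^sub>E UNIV X \<and> (\<forall>i. openin euclideanreal (X i)) \<and>
      finite {i. X i \<noteq> topspace euclideanreal} \<and> Pi\<^sub>E UNIV X \<subseteq> V"
    by (rule product_topology_open_contains_basis[of "\<lambda>i. euclideanreal" UNIV])
  then obtain W where W: "blinfun_apply x \<in> Pi\<^sub>E UNIV W" "\<And>i. open (W i)"
      "finite {i. W i \<noteq> UNIV}" "Pi\<^sub>E UNIV W \<subseteq> V"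
    unfolding topspace_euclidean open_openin[symmetric] by blast
  define F where "F = {i. W i \<noteq> UNIV}"
  have "\<exists>e>0. \<forall>i. \<bar>i - blinfun_apply x a\<bar> \<le> e \<longrightarrow> i \<in> W a" for a
  proof -
    have "blinfun_apply x a \<in> W a" using W(1) by auto
    then obtain e where "e > 0" "cball (blinfun_apply x a) e \<subseteq> W a"
      using W(2)[of a] open_contains_cball by blast
    then show ?thesis
      by (intro exI[of _ e]) (auto simp: subset_iff dist_real_def abs_minus_commute)
  qed
  then obtain e where e: "\<And>a. e a > 0" "\<And>a i. \<bar>i - blinfun_apply x a\<bar> \<le> e a \<Longrightarrow> i \<in> W a"
    by metis
  \<comment> \<open>Inserting 1 keeps the minimum defined and positive when \<open>F\<close> is
    empty.\<close>
  define r where "r = Min (insert 1 (e ` F))"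
  have fin: "finite F" using W(3) F_def by simp
  have "r > 0" unfolding r_def using fin e by simp
  have r: "r \<le> e a" if "a \<in> F" for a
    unfolding r_def using fin that by simp
  have "{y. \<forall>a\<in>F. \<bar>blinfun_apply y a - blinfun_apply x a\<bar> \<le> r} \<subseteq> U"
  proof
    fix y assume y: "y \<in> {y. \<forall>a\<in>F. \<bar>blinfun_apply y a - blinfun_apply x a\<bar> \<le> r}"
    have "blinfun_apply y a \<in> W a" for a
    proof (cases "a \<in> F")
      case True
      then show ?thesis using y r[OF True] e(2)[of "blinfun_apply y a" a] by force
    next
      case False
      then show ?thesis by (simp add: F_def)
    qed
    then have "blinfun_apply y \<in> V" using W(4) by auto
    then show "y \<in> U" using V(2) by simp
  qed
  then show thesis using that fin \<open>r > 0\<close> by blast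
qed

text \<open>The fragment derivation tests closures of neighborhoods, so later arguments need
  neighborhoods whose closure stays inside a given open set. A closed cylinder inside
  \<open>U\<close> contains the closure of the open cylinder of the same radius.\<close>

lemma weak_star_regular:
  assumes "openin weak_star U" "x \<in> U"
  obtains W where "openin weak_star W" "x \<in> W" "weak_star closure_of W \<subseteq> U"
proof -
  obtain F r where *: "finite F" "r > 0"
      "{y. \<forall>a\<in>F. \<bar>blinfun_apply y a - blinfun_apply x a\<bar> \<le> r} \<subseteq> U"
    using weak_star_cylinder_base[OF assms] .
  show thesis
  proof (rule that)
    show "openin weak_star {y. \<forall>a\<in>F. \<bar>blinfun_apply y a - blinfun_apply x a\<bar> < r}"
      using * openin_weak_star_cylinder by blast
    have "weak_star closure_of {y. \<forall>a\<in>F. \<bar>blinfun_apply y a - blinfun_apply x a\<bar> < r}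
        \<subseteq> {y. \<forall>a\<in>F. \<bar>blinfun_apply y a - blinfun_apply x a\<bar> \<le> r}"
      by (rule closure_of_minimal[OF _ closedin_weak_star_cylinder]) auto
    then show "weak_star closure_of {y. \<forall>a\<in>F. \<bar>blinfun_apply y a - blinfun_apply x a\<bar> < r} \<subseteq> U"
      using * by blast
  qed (use * in auto)
qed

lemma Hausdorff_weak_star: "Hausdorff_space weak_star"
  unfolding Hausdorff_space_def
proof (intro allI impI, elim conjE)
  fix x y :: "'a \<Rightarrow>\<^sub>L real"
  assume "x \<noteq> y"
  then obtain a where a: "blinfun_apply x a \<noteq> blinfun_apply y a"
    by (metis blinfun_eqI)
  define r where "r = \<bar>blinfun_apply x a - blinfun_apply y a\<bar> / 2"
  show "\<exists>U V. openin weak_star U \<and> openin weak_star V \<and> x \<in> U \<and> y \<in> V \<and> disjnt U V"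
  proof (intro exI conjI)
    show "openin weak_star {z. \<forall>b\<in>{a}. \<bar>blinfun_apply z b - blinfun_apply x b\<bar> < r}"
      "openin weak_star {z. \<forall>b\<in>{a}. \<bar>blinfun_apply z b - blinfun_apply y b\<bar> < r}"
      by (intro openin_weak_star_cylinder; simp)+
    show "disjnt {z. \<forall>b\<in>{a}. \<bar>blinfun_apply z b - blinfun_apply x b\<bar> < r}
       {z. \<forall>b\<in>{a}. \<bar>blinfun_apply z b - blinfun_apply y b\<bar> < r}"
      by (auto simp: disjnt_def r_def abs_if split: if_splits)
  qed (use a in \<open>auto simp: r_def\<close>)
qed

section \<open>Weak-star compact sets: Banach-Alaoglu and uniform boundedness\<close>

lemmas weak_star_compact_closed = compactin_imp_closedin[OF Hausdorff_weak_star]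

lemma weak_star_compact_Int_closed:
  "compactin weak_star A \<Longrightarrow> closedin weak_star S \<Longrightarrow> compactin weak_star (A \<inter> S)"
  by (metis closed_Int_compactin inf_commute)

lemma weak_star_compact_finite: "finite A \<Longrightarrow> compactin weak_star A"
  by (simp add: finite_imp_compactin)

lemma compactin_weak_star_of_compact: "compact A \<Longrightarrow> compactin weak_star A"
  using image_compactin[OF _ strong_operator_topology_weaker_than_euclidean, of A] by simp

text \<open>Banach-Alaoglu: the linear functions in the product of the intervals
  \<open>{- (r * norm a)..r * norm a}\<close> form a compact set by Tychonoff, and
  \<open>Blinfun\<close> carries it continuously onto the ball.\<close>

lemma weak_star_compact_cball:
  "compactin weak_star (cball (0::'a::real_normed_vector \<Rightarrow>\<^sub>L real) r)"
proof (cases "r \<ge> 0")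
  case True
  let ?P = "Pi\<^sub>E UNIV (\<lambda>a::'a. {- (r * norm a)..r * norm a})"
  define S where "S = ?P \<inter> {g. linear g}"
  have "compactin (product_topology (\<lambda>a::'a. euclideanreal) UNIV) ?P"
    by (simp add: compactin_PiE)
  then have "compact ?P"
    by (simp add: euclidean_product_topology)
  moreover have "closed {g::'a \<Rightarrow> real. linear g}"
  proof -
    have eq: "{g::'a \<Rightarrow> real. linear g}
        = (\<Inter>x y. {g. g (x + y) = g x + g y}) \<inter> (\<Inter>c x. {g. g (c *\<^sub>R x) = c * g x})"
      by (auto simp: linear_iff)
    have coord: "continuous_on UNIV (\<lambda>g::'a \<Rightarrow> real. g x)" for x
      by (rule continuous_on_product_coordinates)
    show ?thesis
      unfolding eq by (intro closed_Int closed_INT ballI closed_Collect_eq continuous_intros coord)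
  qed
  ultimately have "compact S"
    unfolding S_def by (rule compact_Int_closed)
  then have "compactin (top_of_set S) S"
    by (simp add: compactin_subtopology)
  have bl: "bounded_linear g" if "g \<in> S" for g
  proof (rule bounded_linear_intro[where K = r])
    show "norm (g x) \<le> norm x * r" for x
      using that by (auto simp: S_def PiE_iff abs_le_iff mult.commute minus_le_iff)
  qed (use that in \<open>auto simp: S_def linear_iff\<close>)
  have "continuous_map (top_of_set S) weak_star Blinfun"
    unfolding continuous_on_strong_operator_topo_iff_coordinatewise
  proof
    fix x
    have "continuous_map (top_of_set S) euclidean (\<lambda>g. g x)"
      using continuous_on_subset[OF continuous_on_product_coordinates] by simp
    then show "continuous_map (top_of_set S) euclidean (\<lambda>g. blinfun_apply (Blinfun g) x)"
      by (rule continuous_map_eq) (simp add: bl bounded_linear_Blinfun_apply)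
  qed
  with \<open>compactin (top_of_set S) S\<close> have "compactin weak_star (Blinfun ` S)"
    by (rule image_compactin)
  moreover have "Blinfun ` S = cball 0 r"
  proof (intro subset_antisym subsetI)
    fix f assume "f \<in> Blinfun ` S"
    then obtain g where g: "g \<in> S" "f = Blinfun g" by auto
    have "norm f \<le> r"
    proof (rule norm_blinfun_bound[OF True])
      show "norm (blinfun_apply f x) \<le> r * norm x" for x
        using g by (auto simp: bounded_linear_Blinfun_apply[OF bl] S_def PiE_iff abs_le_iff minus_le_iff)
    qed
    then show "f \<in> cball 0 r" by simp
  next
    fix f :: "'a \<Rightarrow>\<^sub>L real" assume "f \<in> cball 0 r"
    then have "norm f \<le> r" by simp
    have "\<bar>blinfun_apply f x\<bar> \<le> r * norm x" for x
      using norm_blinfun[of f x] mult_right_mono[OF \<open>norm f \<le> r\<close>, of "norm x"] by simp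
    then have "blinfun_apply f \<in> S"
      by (auto simp: S_def abs_le_iff minus_le_iff blinfun.bounded_linear_right bounded_linear.linear)
    then show "f \<in> Blinfun ` S"
      by (metis blinfun_apply_inverse image_eqI)
  qed
  ultimately show ?thesis by simp
qed auto

text \<open>Uniform boundedness principle: pointwise bounds make the closed sets \<open>E n\<close>
  cover the Banach space, so by Baire one of them contains a ball.\<close>

lemma weak_star_compact_bounded:
  fixes A :: "('a::banach \<Rightarrow>\<^sub>L real) set"
  assumes "compactin weak_star A"
  obtains R where "R > 0" "A \<subseteq> cball 0 R"
proof -
  define E where "E n = {x. \<forall>f\<in>A. \<bar>blinfun_apply f x\<bar> \<le> real n}" for n
  have closed: "closed (E n)" for n
  proof -
    have "E n = (\<Inter>f\<in>A. {x. \<bar>blinfun_apply f x\<bar> \<le> real n})" by (auto simp: E_def)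
    then show ?thesis
      by (auto intro!: closed_INT closed_Collect_le continuous_intros)
  qed
  have cover: "(\<Union>n. E n) = UNIV"
  proof -
    have "\<exists>n. x \<in> E n" for x
    proof -
      have "compactin euclideanreal ((\<lambda>f. blinfun_apply f x) ` A)"
        by (rule image_compactin[OF assms continuous_map_weak_star_eval])
      then have "bounded ((\<lambda>f. blinfun_apply f x) ` A)"
        by (simp add: compact_imp_bounded)
      then obtain b where b: "\<And>f. f \<in> A \<Longrightarrow> \<bar>blinfun_apply f x\<bar> \<le> b"
        unfolding bounded_iff by auto
      obtain n where "b \<le> real n" using real_arch_simple by blast
      then have "x \<in> E n"
        unfolding E_def using b by (auto intro: order_trans)
      then show ?thesis ..
    qed
    then show ?thesis by auto
  qed
  have "\<exists>n. interior (E n) \<noteq> {}"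
  proof (rule ccontr)
    assume "\<not> ?thesis"
    then have "euclidean interior_of (\<Union>(range E)) = ({}::'a set)"
      by (intro Baire_category_alt)
        (auto simp: completely_metrizable_space_euclidean closed)
    then show False by (simp add: cover)
  qed
  then obtain n x e where "e > 0" and e: "cball x e \<subseteq> E n"
    by (metis all_not_in_conv mem_interior_cball)
  \<comment> \<open>The summand 1 keeps \<open>R\<close> positive when \<open>n = 0\<close>.\<close>
  define R where "R = 2 * real n / e + 1"
  have "R > 0" unfolding R_def using \<open>e > 0\<close> by (simp add: add_nonneg_pos)
  moreover have "A \<subseteq> cball 0 R"
  proof
    fix f assume f: "f \<in> A"
    have "norm f \<le> 2 * real n / e"
    proof (rule norm_blinfun_bound)
      show "0 \<le> 2 * real n / e" using \<open>e > 0\<close> by simp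
      fix z
      show "norm (blinfun_apply f z) \<le> 2 * real n / e * norm z"
      proof (cases "z = 0")
        case False
        \<comment> \<open>\<open>w\<close> is \<open>z\<close> rescaled to norm \<open>e\<close>;
          both \<open>x\<close> and \<open>x + w\<close> lie in the ball, and the difference of
          their values bounds \<open>f\<close> at \<open>w\<close>.\<close>
        define w where "w = (e / norm z) *\<^sub>R z"
        have "x + w \<in> cball x e" "x \<in> cball x e"
          using \<open>e > 0\<close> False by (auto simp: w_def dist_norm)
        then have "\<bar>blinfun_apply f (x + w)\<bar> \<le> real n" "\<bar>blinfun_apply f x\<bar> \<le> real n"
          using e f by (auto simp: E_def subset_iff)
        then have "\<bar>blinfun_apply f w\<bar> \<le> 2 * real n"
          by (auto simp: blinfun.add_right)
        moreover have "blinfun_apply f w = e / norm z * blinfun_apply f z"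
          by (simp add: w_def blinfun.scaleR_right)
        ultimately show ?thesis
          using \<open>e > 0\<close> False by (simp add: abs_mult field_simps)
      qed simp
    qed
    then show "f \<in> cball 0 R" by (simp add: R_def)
  qed
  ultimately show thesis using that by blast
qed

lemma weak_star_compact_of_closed_bounded:
  assumes "closedin weak_star S" "S \<subseteq> cball 0 R"
  shows "compactin weak_star S"
  using closed_compactin[OF weak_star_compact_cball assms(2,1)] .

section \<open>Linear combinations of sets and weak-star closed convex hulls\<close>

definition lincomb :: "real \<Rightarrow> real \<Rightarrow> ('b::real_vector) set \<Rightarrow> 'b set \<Rightarrow> 'b set"
  where "lincomb s t A B = {s *\<^sub>R x + t *\<^sub>R y |x y. x \<in> A \<and> y \<in> B}"

lemma continuous_map_weak_star_lincomb:
  assumes "continuous_map T weak_star f" "continuous_map T weak_star g"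
    "continuous_map T euclideanreal s" "continuous_map T euclideanreal t"
  shows "continuous_map T weak_star (\<lambda>p. s p *\<^sub>R f p + t p *\<^sub>R g p)"
  using assms unfolding continuous_on_strong_operator_topo_iff_coordinatewise
  by (auto simp: blinfun.add_left blinfun.scaleR_left intro!: continuous_intros)

lemma continuous_map_lincomb:
  "continuous_map (prod_topology weak_star weak_star) weak_star (\<lambda>(x, y). s *\<^sub>R x + t *\<^sub>R y)"
  unfolding case_prod_beta
  by (intro continuous_map_weak_star_lincomb continuous_map_fst continuous_map_snd) simp_all

lemma lincomb_image: "lincomb s t A B = (\<lambda>(x, y). s *\<^sub>R x + t *\<^sub>R y) ` (A \<times> B)"
  by (auto simp: lincomb_def image_iff)

lemma weak_star_compact_lincomb:
  assumes "compactin weak_star A" "compactin weak_star B"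
  shows "compactin weak_star (lincomb s t A B)"
  unfolding lincomb_image
  by (rule image_compactin[OF _ continuous_map_lincomb]) (simp add: compactin_Times assms)

definition wconv :: "('a::real_normed_vector \<Rightarrow>\<^sub>L real) set \<Rightarrow> ('a \<Rightarrow>\<^sub>L real) set"
  where "wconv A = weak_star closure_of (convex hull A)"

lemma subset_wconv: "A \<subseteq> wconv A"
  unfolding wconv_def using closure_of_subset[of "convex hull A" weak_star] hull_subset[of A convex]
  by auto

lemma closedin_wconv: "closedin weak_star (wconv A)"
  by (simp add: wconv_def)

lemma wconv_minimal: "A \<subseteq> S \<Longrightarrow> convex S \<Longrightarrow> closedin weak_star S \<Longrightarrow> wconv A \<subseteq> S"
  unfolding wconv_def by (simp add: closure_of_minimal hull_minimal)

text \<open>The closure of \<open>S \<times> S\<close> is the product of the closures, and the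
  combination map is continuous and maps \<open>S \<times> S\<close> into \<open>S\<close>.\<close>

lemma convex_weak_star_closure:
  assumes "convex S"
  shows "convex (weak_star closure_of S)"
proof (rule convexI)
  fix x y and u v :: real
  assume *: "x \<in> weak_star closure_of S" "y \<in> weak_star closure_of S" "0 \<le> u" "0 \<le> v" "u + v = 1"
  let ?f = "\<lambda>(x, y). u *\<^sub>R x + v *\<^sub>R y"
  have "?f ` (prod_topology weak_star weak_star closure_of (S \<times> S)) \<subseteq> weak_star closure_of (?f ` (S \<times> S))"
    by (rule continuous_map_image_closure_subset[OF continuous_map_lincomb])
  moreover have "?f ` (S \<times> S) \<subseteq> S"
    using assms * by (auto simp: convex_def)
  moreover have "(x, y) \<in> prod_topology weak_star weak_star closure_of (S \<times> S)"
    using * by (simp add: closure_of_Times)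
  ultimately show "u *\<^sub>R x + v *\<^sub>R y \<in> weak_star closure_of S"
    using closure_of_mono[of "?f ` (S \<times> S)" S weak_star] by (auto simp: image_subset_iff subset_iff)
qed

lemma convex_wconv: "convex (wconv A)"
  unfolding wconv_def by (intro convex_weak_star_closure convex_convex_hull)

lemma weak_star_compact_wconv:
  fixes A :: "('a::banach \<Rightarrow>\<^sub>L real) set"
  assumes "compactin weak_star A"
  shows "compactin weak_star (wconv A)"
proof -
  obtain R where R: "A \<subseteq> cball 0 R"
    using weak_star_compact_bounded[OF assms] .
  show ?thesis
    by (rule weak_star_compact_of_closed_bounded[OF closedin_wconv wconv_minimal[OF R]])
      (auto intro: weak_star_compact_closed weak_star_compact_cball)
qed

subsection \<open>Convex combinations of sets\<close>

text \<open>Convexity with total weight \<open>p + q\<close> in place of 1. Allowing weight 0 spares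
  the later computations any division.\<close>

lemma convex_nonneg_comb:
  assumes "convex S" "u \<in> S" "v \<in> S" "0 \<le> p" "0 \<le> (q::real)"
  obtains w where "w \<in> S" "p *\<^sub>R u + q *\<^sub>R v = (p + q) *\<^sub>R w"
proof (cases "p + q = 0")
  case True
  then have "p = 0" "q = 0" using assms by auto
  then show ?thesis using that[of u] assms by simp
next
  case False
  then have "(p / (p + q)) *\<^sub>R u + (q / (p + q)) *\<^sub>R v \<in> S"
    using assms by (intro convexD) (auto simp: add_divide_distrib[symmetric])
  moreover have "p *\<^sub>R u + q *\<^sub>R v = (p + q) *\<^sub>R ((p / (p + q)) *\<^sub>R u + (q / (p + q)) *\<^sub>R v)"
    using False by (simp add: scaleR_add_right)
  ultimately show ?thesis using that by blast
qed

lemma convex_lincomb: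
  assumes "convex A" "convex B"
  shows "convex (lincomb s t A B)"
proof (rule convexI)
  fix x y and u v :: real
  assume *: "x \<in> lincomb s t A B" "y \<in> lincomb s t A B" "0 \<le> u" "0 \<le> v" "u + v = 1"
  then obtain a b a' b' where ab: "a \<in> A" "a' \<in> A" "b \<in> B" "b' \<in> B"
      "x = s *\<^sub>R a + t *\<^sub>R b" "y = s *\<^sub>R a' + t *\<^sub>R b'"
    by (auto simp: lincomb_def)
  have "u *\<^sub>R x + v *\<^sub>R y = s *\<^sub>R (u *\<^sub>R a + v *\<^sub>R a') + t *\<^sub>R (u *\<^sub>R b + v *\<^sub>R b')"
    by (simp add: ab algebra_simps)
  then show "u *\<^sub>R x + v *\<^sub>R y \<in> lincomb s t A B"
    unfolding lincomb_def using ab * assms by (blast dest: convexD)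
qed

text \<open>The join of two sets: the weight \<open>s\<close> varies, whereas in
  \<open>lincomb\<close> it is fixed. It serves to split an element of the hull of a union into a
  part from each set.\<close>

definition segments :: "('b::real_vector) set \<Rightarrow> 'b set \<Rightarrow> 'b set"
  where "segments P Q = {s *\<^sub>R u + (1 - s) *\<^sub>R v |s u v. 0 \<le> s \<and> s \<le> 1 \<and> u \<in> P \<and> v \<in> Q}"

lemma weak_star_compact_segments:
  assumes "compactin weak_star P" "compactin weak_star Q"
  shows "compactin weak_star (segments P Q)"
proof -
  let ?X = "prod_topology euclideanreal (prod_topology weak_star weak_star)"
  let ?f = "\<lambda>p. fst p *\<^sub>R fst (snd p) + (1 - fst p) *\<^sub>R snd (snd p)"
  have "compactin ?X ({0..1} \<times> (P \<times> Q))"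
    using assms by (simp add: compactin_Times)
  moreover have "continuous_map ?X euclideanreal fst"
    by (rule continuous_map_fst)
  then have "continuous_map ?X weak_star ?f"
    by (intro continuous_map_weak_star_lincomb continuous_map_snd_of continuous_map_diff
        continuous_map_compose[OF continuous_map_snd continuous_map_fst, unfolded o_def]
        continuous_map_compose[OF continuous_map_snd continuous_map_snd, unfolded o_def]) simp_all
  ultimately have "compactin weak_star (?f ` ({0..1} \<times> (P \<times> Q)))"
    by (rule image_compactin)
  moreover have "?f ` ({0..1} \<times> (P \<times> Q)) = segments P Q"
    by (force simp: segments_def image_iff)
  ultimately show ?thesis by simp
qed

lemma convex_segments:
  assumes "convex P" "convex Q"
  shows "convex (segments P Q)"
proof (rule convexI)
  fix x y and \<alpha> \<beta> :: real
  assume *: "x \<in> segments P Q" "y \<in> segments P Q" "0 \<le> \<alpha>" "0 \<le> \<beta>" "\<alpha> + \<beta> = 1"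
  then obtain s u v s' u' v' where s: "0 \<le> s" "s \<le> 1" "u \<in> P" "v \<in> Q" "x = s *\<^sub>R u + (1 - s) *\<^sub>R v"
      "0 \<le> s'" "s' \<le> 1" "u' \<in> P" "v' \<in> Q" "y = s' *\<^sub>R u' + (1 - s') *\<^sub>R v'"
    unfolding segments_def by auto
  obtain p where p: "p \<in> P" "(\<alpha> * s) *\<^sub>R u + (\<beta> * s') *\<^sub>R u' = (\<alpha> * s + \<beta> * s') *\<^sub>R p"
    using convex_nonneg_comb[OF assms(1) s(3,8), of "\<alpha> * s" "\<beta> * s'"] s * by auto
  obtain q where q: "q \<in> Q" "(\<alpha> * (1 - s)) *\<^sub>R v + (\<beta> * (1 - s')) *\<^sub>R v' = (\<alpha> * (1 - s) + \<beta> * (1 - s')) *\<^sub>R q"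
    using convex_nonneg_comb[OF assms(2) s(4,9), of "\<alpha> * (1 - s)" "\<beta> * (1 - s')"] s * by auto
  have "\<alpha> *\<^sub>R x + \<beta> *\<^sub>R y = ((\<alpha> * s) *\<^sub>R u + (\<beta> * s') *\<^sub>R u') + ((\<alpha> * (1 - s)) *\<^sub>R v + (\<beta> * (1 - s')) *\<^sub>R v')"
    by (simp add: s scaleR_add_right)
  also have "\<dots> = (\<alpha> * s + \<beta> * s') *\<^sub>R p + (\<alpha> * (1 - s) + \<beta> * (1 - s')) *\<^sub>R q"
    by (simp only: p q)
  also have "\<alpha> * (1 - s) + \<beta> * (1 - s') = 1 - (\<alpha> * s + \<beta> * s')"
    using *(5) by (simp add: algebra_simps)
  finally have eq: "\<alpha> *\<^sub>R x + \<beta> *\<^sub>R y = (\<alpha> * s + \<beta> * s') *\<^sub>R p + (1 - (\<alpha> * s + \<beta> * s')) *\<^sub>R q" .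
  have "\<alpha> * s + \<beta> * s' \<le> \<alpha> * 1 + \<beta> * 1"
    using s * by (intro add_mono mult_left_mono) auto
  then have "0 \<le> \<alpha> * s + \<beta> * s' \<and> \<alpha> * s + \<beta> * s' \<le> 1"
    using s * by simp
  with eq p(1) q(1) show "\<alpha> *\<^sub>R x + \<beta> *\<^sub>R y \<in> segments P Q"
    unfolding segments_def by blast
qed

lemma wconv_mono: "A \<subseteq> B \<Longrightarrow> wconv A \<subseteq> wconv B"
  unfolding wconv_def by (intro closure_of_mono hull_mono)

text \<open>The join is compact and convex, and contains \<open>P\<close> and \<open>Q\<close> as
  the cases \<open>s = 1\<close> and \<open>s = 0\<close>; nonemptiness supplies the partner of
  weight 0.\<close>

lemma wconv_subset_segments:
  assumes "compactin weak_star P" "compactin weak_star Q" "convex P" "convex Q" "P \<noteq> {}" "Q \<noteq> {}" "A \<subseteq> P \<union> Q"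
  shows "wconv A \<subseteq> segments P Q"
proof (rule wconv_minimal)
  show "A \<subseteq> segments P Q"
  proof
    fix x assume "x \<in> A"
    obtain p q where "p \<in> P" "q \<in> Q" using assms by blast
    have "x \<in> segments P Q" if "x \<in> P"
      unfolding segments_def using that \<open>q \<in> Q\<close>
      by (intro CollectI exI[of _ 1] exI[of _ x] exI[of _ q]) simp
    moreover have "x \<in> segments P Q" if "x \<in> Q"
      unfolding segments_def using that \<open>p \<in> P\<close>
      by (intro CollectI exI[of _ 0] exI[of _ p] exI[of _ x]) simp
    ultimately show "x \<in> segments P Q"
      using \<open>x \<in> A\<close> assms by blast
  qed
qed (use assms in \<open>auto intro: convex_segments weak_star_compact_closed weak_star_compact_segments\<close>)

subsection \<open>Iterated fragment derivations\<close>

text \<open>No clause has a multiplicative loss, so the properties reproduce themselves exactly for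
  \<open>omega_measure \<eta>\<close> and nothing accumulates over the induction. The term
  \<open>2 * r\<close> is the diameter of the ball, matching the normalization of
  \<open>kuratowski\<close>.\<close>

locale convex_mnc =
  fixes \<eta> :: "('a::banach \<Rightarrow>\<^sub>L real) set \<Rightarrow> real"
  assumes eta_mono: "\<And>A B. compactin weak_star A \<Longrightarrow> compactin weak_star B \<Longrightarrow> A \<subseteq> B \<Longrightarrow> \<eta> A \<le> \<eta> B"
    and eta_Un: "\<And>A B. compactin weak_star A \<Longrightarrow> compactin weak_star B \<Longrightarrow> \<eta> (A \<union> B) \<le> max (\<eta> A) (\<eta> B)"
    and eta_singleton: "\<And>x. \<eta> {x} \<le> 0"
    and eta_lincomb: "\<And>A B t. compactin weak_star A \<Longrightarrow> compactin weak_star B \<Longrightarrow> 0 \<le> t \<Longrightarrow> t \<le> 1 \<Longrightarrow>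
        \<eta> (lincomb t (1 - t) A B) \<le> max (\<eta> A) (\<eta> B)"
    and eta_cball: "\<And>A r. compactin weak_star A \<Longrightarrow> 0 \<le> r \<Longrightarrow>
        \<eta> (lincomb 1 1 A (cball 0 r)) \<le> \<eta> A + 2 * r"
    and eta_wconv: "\<And>A. compactin weak_star A \<Longrightarrow> \<eta> (wconv A) \<le> \<eta> A"
begin

abbreviation D :: "real \<Rightarrow> ('a \<Rightarrow>\<^sub>L real) set \<Rightarrow> ('a \<Rightarrow>\<^sub>L real) set"
  where "D \<equiv> fragment_deriv \<eta>"

section \<open>Compactness, locality and unions for iterated derivations\<close>

lemma eta_finite_UN:
  assumes "finite I" "\<And>i. i \<in> I \<Longrightarrow> compactin weak_star (S i)" "\<And>i. i \<in> I \<Longrightarrow> \<eta> (S i) < c" "0 < c"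
  shows "\<eta> (\<Union>i\<in>I. S i) < c"
  using assms(1-3)
proof (induction rule: finite_induct)
  case empty
  \<comment> \<open>No clause of the locale speaks of the empty set; monotonicity bounds it by a
    singleton.\<close>
  have "\<eta> {} \<le> \<eta> {undefined}"
    by (intro eta_mono weak_star_compact_finite) auto
  then show ?case
    using eta_singleton[of undefined] \<open>0 < c\<close> by simp
next
  case (insert i I)
  have "\<eta> (S i \<union> (\<Union>i\<in>I. S i)) \<le> max (\<eta> (S i)) (\<eta> (\<Union>i\<in>I. S i))"
    using insert by (intro eta_Un compactin_Union) auto
  also have "\<dots> < c"
    using insert by simp
  finally show ?case by simp
qed

lemma compact_Int_closure: "compactin weak_star A \<Longrightarrow> compactin weak_star (A \<inter> weak_star closure_of U)"
  by (intro weak_star_compact_Int_closed) auto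

text \<open>By monotonicity of \<open>\<eta>\<close> it suffices to test open neighborhoods.\<close>

lemma deriv_iff:
  assumes "compactin weak_star A"
  shows "x \<in> D c A \<longleftrightarrow> x \<in> A \<and> (\<forall>U. openin weak_star U \<longrightarrow> x \<in> U \<longrightarrow> c \<le> \<eta> (A \<inter> weak_star closure_of U))"
proof -
  have "c \<le> \<eta> (A \<inter> weak_star closure_of U)"
    if "\<forall>U. openin weak_star U \<longrightarrow> x \<in> U \<longrightarrow> c \<le> \<eta> (A \<inter> weak_star closure_of U)"
      and nhd: "weak_star_nhd x U" for U
  proof -
    obtain V where V: "openin weak_star V" "x \<in> V" "V \<subseteq> U"
      using nhd unfolding weak_star_nhd_def by blast
    then have "c \<le> \<eta> (A \<inter> weak_star closure_of V)"
      using that by blast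
    also have "\<dots> \<le> \<eta> (A \<inter> weak_star closure_of U)"
      using closure_of_mono[OF V(3), of weak_star]
      by (intro eta_mono compact_Int_closure assms) blast
    finally show ?thesis .
  qed
  then show ?thesis
    unfolding fragment_deriv_def weak_star_nhd_def by blast
qed

lemma deriv_subset: "D c A \<subseteq> A"
  by (auto simp: fragment_deriv_def)

lemma compact_deriv:
  assumes "compactin weak_star A"
  shows "compactin weak_star (D c A)"
proof -
  \<comment> \<open>A point of \<open>A\<close> is removed exactly when it lies in the open set
    \<open>?O\<close>, so the derivative is relatively closed in \<open>A\<close>.\<close>
  let ?O = "\<Union>{U. openin weak_star U \<and> \<eta> (A \<inter> weak_star closure_of U) < c}"
  have "D c A = A \<inter> (UNIV - ?O)"
  proof (intro set_eqI iffI)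
    fix x assume "x \<in> A \<inter> (UNIV - ?O)"
    then show "x \<in> D c A"
      unfolding deriv_iff[OF assms] by (auto intro: leI)
  next
    fix x assume "x \<in> D c A"
    then show "x \<in> A \<inter> (UNIV - ?O)"
      unfolding deriv_iff[OF assms] by (auto simp: not_le[symmetric])
  qed
  moreover have "closedin weak_star (topspace weak_star - ?O)"
    by (rule closedin_diff[OF closedin_topspace openin_Union]) auto
  ultimately show ?thesis
    using weak_star_compact_Int_closed[OF assms] by simp
qed

lemma compact_iter: "compactin weak_star A \<Longrightarrow> compactin weak_star ((D c ^^ k) A)"
  by (induction k) (auto intro: compact_deriv)

lemma iter_subset: "(D c ^^ k) A \<subseteq> A"
proof (induction k)
  case (Suc k)
  then show ?case
    using deriv_subset[of c "(D c ^^ k) A"] by simp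
qed simp

lemma iter_empty [simp]: "(D c ^^ k) {} = {}"
  using iter_subset[of k c "{}"] by auto

lemma iter_decreasing: "k \<le> l \<Longrightarrow> (D c ^^ l) A \<subseteq> (D c ^^ k) A"
  using iter_subset[of "l - k" c "(D c ^^ k) A"] by (metis comp_apply funpow_add le_add_diff_inverse2)

text \<open>Membership in the derivative depends only on small neighborhoods: intersecting a test
  set \<open>U\<close> with some \<open>V\<close> whose closure lies in \<open>W\<close> leaves a
  piece of \<open>B\<close> contained in \<open>E\<close>. Iterated with \<open>W = UNIV\<close>,
  this gives monotonicity.\<close>

lemma deriv_local:
  assumes "compactin weak_star B" "compactin weak_star E" "openin weak_star W" "B \<inter> W \<subseteq> E" "c' \<le> c"
  shows "D c B \<inter> W \<subseteq> D c' E"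
proof
  fix x assume x: "x \<in> D c B \<inter> W"
  obtain V where V: "openin weak_star V" "x \<in> V" "weak_star closure_of V \<subseteq> W"
    using weak_star_regular[OF assms(3)] x by blast
  have "c' \<le> \<eta> (E \<inter> weak_star closure_of U)" if U: "openin weak_star U" "x \<in> U" for U
  proof -
    have "c \<le> \<eta> (B \<inter> weak_star closure_of (U \<inter> V))"
      using x U V by (simp add: deriv_iff[OF assms(1)] openin_Int)
    also have "\<dots> \<le> \<eta> (E \<inter> weak_star closure_of U)"
    proof (intro eta_mono compact_Int_closure assms(1,2))
      show "B \<inter> weak_star closure_of (U \<inter> V) \<subseteq> E \<inter> weak_star closure_of U"
        using closure_of_mono[of "U \<inter> V" U weak_star] closure_of_mono[of "U \<inter> V" V weak_star] V(3) assms(4)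
        by blast
    qed
    finally show ?thesis using assms(5) by simp
  qed
  then show "x \<in> D c' E"
    using x assms(4) deriv_subset[of c B] by (auto simp: deriv_iff[OF assms(2)])
qed

lemma iter_local:
  assumes "compactin weak_star B" "compactin weak_star E" "openin weak_star W" "B \<inter> W \<subseteq> E" "c' \<le> c"
  shows "(D c ^^ k) B \<inter> W \<subseteq> (D c' ^^ k) E"
proof (induction k)
  case (Suc k)
  then show ?case
    using deriv_local[OF compact_iter[OF assms(1)] compact_iter[OF assms(2)] assms(3) _ assms(5)] by simp
qed (use assms in simp)

lemma iter_mono:
  assumes "compactin weak_star B" "compactin weak_star E" "B \<subseteq> E" "c' \<le> c"
  shows "(D c ^^ k) B \<subseteq> (D c' ^^ k) E"
  using iter_local[OF assms(1,2), of UNIV c' c k] assms openin_topspace[of weak_star] by auto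

text \<open>Outside both derivatives there are neighborhoods on which \<open>A\<close> and
  \<open>B\<close> are small; on their intersection \<open>eta_Un\<close> makes the union
  small.\<close>

lemma deriv_Un:
  assumes A: "compactin weak_star A" and B: "compactin weak_star B"
  shows "D c (A \<union> B) \<subseteq> D c A \<union> D c B"
proof
  fix x assume x: "x \<in> D c (A \<union> B)"
  note AB = compactin_Un[OF A B]
  show "x \<in> D c A \<union> D c B"
  proof (rule ccontr)
    assume neg: "x \<notin> D c A \<union> D c B"
    \<comment> \<open>An empty intersection is kept as a separate alternative: \<open>c\<close> may
      be nonpositive, and then emptiness need not give a value below \<open>c\<close>.\<close>
    have *: "\<exists>U. openin weak_star U \<and> x \<in> U \<and> (S \<inter> weak_star closure_of U = {} \<or> \<eta> (S \<inter> weak_star closure_of U) < c)"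
      if S: "compactin weak_star S" "x \<notin> D c S" for S
    proof (cases "x \<in> S")
      case True
      then show ?thesis using S by (auto simp: deriv_iff not_le)
    next
      case False
      have "openin weak_star (UNIV - S)"
        using weak_star_compact_closed[OF S(1)] by (simp add: closedin_def)
      then obtain V where "openin weak_star V" "x \<in> V" "weak_star closure_of V \<subseteq> UNIV - S"
        using weak_star_regular[of "UNIV - S" x] False by blast
      then show ?thesis by blast
    qed
    obtain U V where U: "openin weak_star U" "x \<in> U" "A \<inter> weak_star closure_of U = {} \<or> \<eta> (A \<inter> weak_star closure_of U) < c"
      and V: "openin weak_star V" "x \<in> V" "B \<inter> weak_star closure_of V = {} \<or> \<eta> (B \<inter> weak_star closure_of V) < c"
      using *[OF A] *[OF B] neg by auto
    let ?A = "A \<inter> weak_star closure_of U" and ?B = "B \<inter> weak_star closure_of V"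
    have "c \<le> \<eta> ((A \<union> B) \<inter> weak_star closure_of (U \<inter> V))"
      using x U V by (simp add: deriv_iff[OF AB] openin_Int)
    also have "\<dots> \<le> \<eta> (?A \<union> ?B)"
      using closure_of_mono[of "U \<inter> V" U weak_star] closure_of_mono[of "U \<inter> V" V weak_star]
      by (intro eta_mono compactin_Un compact_Int_closure A B) blast+
    finally have "c \<le> \<eta> (?A \<union> ?B)" .
    moreover have "\<eta> (?A \<union> ?B) \<le> max (\<eta> ?A) (\<eta> ?B)"
      by (intro eta_Un compact_Int_closure A B)
    \<comment> \<open>The point \<open>x\<close> itself rules out that both pieces are
      empty.\<close>
    moreover have "x \<in> ?A \<union> ?B"
      using x deriv_subset[of c "A \<union> B"] closure_of_subset[of U weak_star] closure_of_subset[of V weak_star] U V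
      by auto
    ultimately show False
      using U(3) V(3) by (auto simp: max_def split: if_splits)
  qed
qed

lemma iter_Un:
  assumes "compactin weak_star A" "compactin weak_star B"
  shows "(D c ^^ k) (A \<union> B) \<subseteq> (D c ^^ k) A \<union> (D c ^^ k) B"
proof (induction k)
  case (Suc k)
  have "D c ((D c ^^ k) (A \<union> B)) \<subseteq> D c ((D c ^^ k) A \<union> (D c ^^ k) B)"
    using iter_mono[of _ _ c c 1] Suc by (simp add: compact_iter compactin_Un assms)
  also have "\<dots> \<subseteq> D c ((D c ^^ k) A) \<union> D c ((D c ^^ k) B)"
    by (intro deriv_Un compact_iter assms)
  finally show ?case by simp
qed simp

lemma deriv_empty_of_small:
  assumes "compactin weak_star A" "\<eta> A < c"
  shows "D c A = {}"
proof -
  have "\<eta> (A \<inter> weak_star closure_of UNIV) < c"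
    using assms closure_of_topspace[of weak_star] by simp
  moreover have "weak_star_nhd x UNIV" for x :: "'a \<Rightarrow>\<^sub>L real"
    unfolding weak_star_nhd_def using openin_topspace[of weak_star] by auto
  ultimately show ?thesis
    unfolding fragment_deriv_def not_le[symmetric] by blast
qed

text \<open>Partial converse of \<open>deriv_empty_of_small\<close>: each point of \<open>K\<close>
  has a neighborhood on which \<open>A\<close> is small, and finitely many of these cover
  \<open>K\<close>. Positivity of \<open>c\<close> handles an empty \<open>K\<close>.\<close>

lemma small_of_deriv_disjoint:
  assumes A: "compactin weak_star A" and K: "compactin weak_star K" "K \<subseteq> A" "K \<inter> D c A = {}" and "0 < c"
  shows "\<eta> K < c"
proof -
  have "\<exists>U. openin weak_star U \<and> x \<in> U \<and> \<eta> (A \<inter> weak_star closure_of U) < c" if "x \<in> K" for x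
    using K that by (auto simp: deriv_iff[OF A] not_le disjoint_iff)
  then obtain U where U: "\<And>x. x \<in> K \<Longrightarrow> openin weak_star (U x) \<and> x \<in> U x \<and> \<eta> (A \<inter> weak_star closure_of U x) < c"
    by metis
  obtain \<F> where "finite \<F>" "\<F> \<subseteq> U ` K" "K \<subseteq> \<Union>\<F>"
    using compactinD[OF K(1), of "U ` K"] U by auto
  then obtain I where I: "finite I" "I \<subseteq> K" "K \<subseteq> (\<Union>x\<in>I. U x)"
    by (metis finite_subset_image)
  have "K \<subseteq> (\<Union>x\<in>I. A \<inter> weak_star closure_of U x)"
    using I K(2) closure_of_subset[of "U _" weak_star] by force
  then have "\<eta> K \<le> \<eta> (\<Union>x\<in>I. A \<inter> weak_star closure_of U x)"
    using I K(1) by (intro eta_mono compactin_Union) (auto intro: compact_Int_closure A)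
  also have "\<dots> < c"
    by (rule eta_finite_UN) (use I U \<open>0 < c\<close> compact_Int_closure[OF A] in auto)
  finally show ?thesis .
qed

section \<open>Derivations of sums, as continuous images of products\<close>

text \<open>A tube-lemma argument: if \<open>z\<close> is outside the right-hand side, the fibre
  over \<open>z\<close> is covered by finitely many boxes on which both factors are small. The
  separate thresholds \<open>a\<close> and \<open>b\<close> allow one factor to be made
  inert.\<close>

lemma deriv_image_Times:
  assumes A: "compactin weak_star A" and B: "compactin weak_star B"
    and f: "continuous_map (prod_topology weak_star weak_star) weak_star f"
    and "0 < c"
    and small: "\<And>P Q. \<lbrakk>compactin weak_star P; compactin weak_star Q; P \<subseteq> A; Q \<subseteq> B; \<eta> P < a; \<eta> Q < b\<rbrakk>
       \<Longrightarrow> \<eta> (f ` (P \<times> Q)) < c"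
  shows "D c (f ` (A \<times> B)) \<subseteq> f ` (D a A \<times> B) \<union> f ` (A \<times> D b B)"
proof
  let ?X = "prod_topology weak_star weak_star"
  have comp: "compactin ?X (P \<times> Q)" if "compactin weak_star P" "compactin weak_star Q" for P Q
    using that by (simp add: compactin_Times)
  have compf: "compactin weak_star (f ` (P \<times> Q))" if "compactin weak_star P" "compactin weak_star Q" for P Q
    using image_compactin[OF comp[OF that] f] .
  fix z assume z: "z \<in> D c (f ` (A \<times> B))"
  show "z \<in> f ` (D a A \<times> B) \<union> f ` (A \<times> D b B)"
  proof (rule ccontr)
    assume neg: "z \<notin> f ` (D a A \<times> B) \<union> f ` (A \<times> D b B)"
    define S where "S = A \<times> B \<inter> {p \<in> topspace ?X. f p \<in> {z}}"
    have "closedin ?X {p \<in> topspace ?X. f p \<in> {z}}"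
      by (intro closedin_continuous_map_preimage[OF f] weak_star_compact_closed weak_star_compact_finite) simp
    then have S: "compactin ?X S"
      unfolding S_def by (subst inf_commute) (rule closed_Int_compactin[OF _ comp[OF A B]])
    define R where "R p U V \<longleftrightarrow> openin weak_star U \<and> openin weak_star V \<and> p \<in> U \<times> V \<and>
        \<eta> (A \<inter> weak_star closure_of U) < a \<and> \<eta> (B \<inter> weak_star closure_of V) < b" for p U V
    have "\<exists>U V. R p U V" if pS: "p \<in> S" for p
    proof -
      obtain x y where p: "p = (x, y)" "x \<in> A" "y \<in> B" "f (x, y) = z"
        using pS unfolding S_def by auto
      then have "x \<notin> D a A" "y \<notin> D b B"
        using neg by force+
      then show ?thesis
        unfolding p(1) R_def using p by (auto simp: deriv_iff A B not_le)
    qed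
    then obtain U V where "\<And>p. p \<in> S \<Longrightarrow> R p (U p) (V p)"
      by metis
    then have UV: "openin weak_star (U p)" "openin weak_star (V p)" "p \<in> U p \<times> V p"
        "\<eta> (A \<inter> weak_star closure_of U p) < a" "\<eta> (B \<inter> weak_star closure_of V p) < b" if "p \<in> S" for p
      using that unfolding R_def by blast+
    have op: "openin ?X (U p \<times> V p)" if "p \<in> S" for p
      using UV(1,2)[OF that] by (simp add: openin_prod_Times_iff)
    obtain \<F> where \<F>: "finite \<F>" "\<F> \<subseteq> (\<lambda>p. U p \<times> V p) ` S" "S \<subseteq> \<Union>\<F>"
      using compactinD[OF S, of "(\<lambda>p. U p \<times> V p) ` S"] UV(3) op by blast
    obtain I where "finite I" "I \<subseteq> S" "\<F> = (\<lambda>p. U p \<times> V p) ` I"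
      using finite_subset_image[OF \<F>(1,2)] by blast
    with \<F>(3) have I: "finite I" "I \<subseteq> S" "S \<subseteq> (\<Union>p\<in>I. U p \<times> V p)"
      by simp_all
    define O' where "O' = (\<Union>p\<in>I. U p \<times> V p)"
    have "openin ?X O'"
      unfolding O'_def using I op by (intro openin_Union) auto
    then have "closedin ?X (topspace ?X - O')"
      by blast
    then have "compactin ?X ((topspace ?X - O') \<inter> A \<times> B)"
      by (rule closed_Int_compactin[OF _ comp[OF A B]])
    then have "closedin weak_star (f ` ((topspace ?X - O') \<inter> A \<times> B))"
      by (intro weak_star_compact_closed image_compactin[OF _ f])
    then have "openin weak_star (UNIV - f ` ((topspace ?X - O') \<inter> A \<times> B))"
      by (simp add: closedin_def)
    moreover have "z \<in> UNIV - f ` ((topspace ?X - O') \<inter> A \<times> B)"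
      using I(3) by (auto simp: S_def O'_def)
    \<comment> \<open>The points of \<open>A \<times> B\<close> outside the boxes have a compact
      image missing \<open>z\<close>, so a neighborhood of \<open>z\<close> with closure off that
      image sees only the boxes.\<close>
    ultimately obtain W where W: "openin weak_star W" "z \<in> W"
        "weak_star closure_of W \<subseteq> UNIV - f ` ((topspace ?X - O') \<inter> A \<times> B)"
      using weak_star_regular by blast
    let ?S = "\<lambda>p. f ` ((A \<inter> weak_star closure_of U p) \<times> (B \<inter> weak_star closure_of V p))"
    have "c \<le> \<eta> (f ` (A \<times> B) \<inter> weak_star closure_of W)"
      using z W by (simp add: deriv_iff[OF compf[OF A B]])
    also have "\<dots> \<le> \<eta> (\<Union>p\<in>I. ?S p)"
    proof (rule eta_mono)
      show "compactin weak_star (\<Union>p\<in>I. ?S p)"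
        using I by (intro compactin_Union) (auto intro!: compf compact_Int_closure A B)
      show "f ` (A \<times> B) \<inter> weak_star closure_of W \<subseteq> (\<Union>p\<in>I. ?S p)"
      proof
        fix w assume w: "w \<in> f ` (A \<times> B) \<inter> weak_star closure_of W"
        then obtain q where q: "q \<in> A \<times> B" "w = f q" by blast
        have "q \<in> O'"
          using w q W(3) by (auto simp: image_iff)
        then obtain p where p: "p \<in> I" "q \<in> U p \<times> V p"
          by (auto simp: O'_def)
        moreover have "U p \<subseteq> weak_star closure_of U p" "V p \<subseteq> weak_star closure_of V p"
          by (simp_all add: closure_of_subset)
        ultimately have "q \<in> (A \<inter> weak_star closure_of U p) \<times> (B \<inter> weak_star closure_of V p)"
          using q by auto
        then show "w \<in> (\<Union>p\<in>I. ?S p)"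
          using p q by blast
      qed
    qed (intro compact_Int_closure compf A B)
    also have "\<dots> < c"
      using I UV \<open>0 < c\<close>
      by (intro eta_finite_UN compf compact_Int_closure A B small) auto
    finally show False by simp
  qed
qed

text \<open>Each derivation leaves a union of two combinations in which one factor has been derived;
  either way \<open>p + q\<close> drops by 1.\<close>

lemma iter_lincomb_empty:
  assumes "0 < c" "0 \<le> t" "t \<le> 1" "compactin weak_star A" "compactin weak_star B"
    "(D c ^^ p) A = {}" "(D c ^^ q) B = {}"
  shows "(D c ^^ (p + q)) (lincomb t (1 - t) A B) = {}"
  using assms(4-)
proof (induction "p + q" arbitrary: p q A B)
  case 0
  then show ?case by (simp add: lincomb_def)
next
  case (Suc n)
  show ?case
  proof (cases "p = 0 \<or> q = 0")
    \<comment> \<open>A count of 0 means that the factor itself is empty.\<close>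
    case True
    then have "lincomb t (1 - t) A B = {}"
      using Suc.prems by (auto simp: lincomb_def)
    then show ?thesis by simp
  next
    case False
    then obtain p' q' where pq: "p = Suc p'" "q = Suc q'"
      by (meson not0_implies_Suc)
    let ?l = "lincomb t (1 - t)"
    have sub: "D c (?l A B) \<subseteq> ?l (D c A) B \<union> ?l A (D c B)"
      unfolding lincomb_image
    proof (rule deriv_image_Times[OF Suc.prems(1,2) continuous_map_lincomb \<open>0 < c\<close>])
      fix P Q assume "compactin weak_star P" "compactin weak_star Q" "\<eta> P < c" "\<eta> Q < c"
      then show "\<eta> ((\<lambda>(x, y). t *\<^sub>R x + (1 - t) *\<^sub>R y) ` (P \<times> Q)) < c"
        using eta_lincomb[of P Q t] assms unfolding lincomb_image by simp
    qed
    have 1: "(D c ^^ n) (?l (D c A) B) = {}"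
      using Suc.hyps(1)[of p' q "D c A" B] Suc.hyps(2) Suc.prems pq
      by (simp add: compact_deriv funpow_Suc_right del: funpow.simps)
    have 2: "(D c ^^ n) (?l A (D c B)) = {}"
      using Suc.hyps(1)[of p q' A "D c B"] Suc.hyps(2) Suc.prems pq
      by (simp add: compact_deriv funpow_Suc_right del: funpow.simps)
    have "(D c ^^ n) (D c (?l A B)) \<subseteq> (D c ^^ n) (?l (D c A) B \<union> ?l A (D c B))"
      using Suc.prems by (intro iter_mono sub compactin_Un weak_star_compact_lincomb compact_deriv) auto
    also have "\<dots> \<subseteq> (D c ^^ n) (?l (D c A) B) \<union> (D c ^^ n) (?l A (D c B))"
      using Suc.prems by (intro iter_Un weak_star_compact_lincomb compact_deriv)
    finally show ?thesis
      using 1 2 Suc.hyps(2)[symmetric] by (simp add: funpow_Suc_right del: funpow.simps)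
  qed
qed

text \<open>Only the factor \<open>A\<close> is derived, so the count stays \<open>p\<close> and the
  threshold is raised by \<open>2 * r\<close> once, not in each step.\<close>

lemma iter_cball_empty:
  assumes "0 < c" "0 \<le> r" "compactin weak_star A" "(D c ^^ p) A = {}"
  shows "(D (c + 2 * r) ^^ p) (lincomb 1 1 A (cball 0 r)) = {}"
  using assms(3-)
proof (induction p arbitrary: A)
  case 0
  then show ?case by (simp add: lincomb_def)
next
  case (Suc p)
  let ?B = "cball 0 r :: ('a \<Rightarrow>\<^sub>L real) set"
  have B: "compactin weak_star ?B" by (rule weak_star_compact_cball)
  \<comment> \<open>The threshold for \<open>?B\<close> is taken so large that its derivative is empty.\<close>
  have "D (c + 2 * r) (lincomb 1 1 A ?B) \<subseteq> lincomb 1 1 (D c A) ?B \<union> lincomb 1 1 A (D (\<eta> ?B + 1) ?B)"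
    unfolding lincomb_image
  proof (rule deriv_image_Times[OF Suc.prems(1) B continuous_map_lincomb])
    fix P Q assume P: "compactin weak_star P" "\<eta> P < c" and Q: "compactin weak_star Q" "Q \<subseteq> ?B"
    have "\<eta> (lincomb 1 1 P Q) \<le> \<eta> (lincomb 1 1 P ?B)"
      by (intro eta_mono weak_star_compact_lincomb P Q B) (use Q in \<open>auto simp: lincomb_def subset_iff\<close>)
    also have "\<dots> < c + 2 * r"
      using eta_cball[OF P(1) \<open>0 \<le> r\<close>] P(2) by simp
    finally show "\<eta> ((\<lambda>(x, y). 1 *\<^sub>R x + 1 *\<^sub>R y) ` (P \<times> Q)) < c + 2 * r"
      unfolding lincomb_image .
  qed (use assms in auto)
  also have "D (\<eta> ?B + 1) ?B = {}"
    by (rule deriv_empty_of_small[OF B]) simp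
  finally have sub: "D (c + 2 * r) (lincomb 1 1 A ?B) \<subseteq> lincomb 1 1 (D c A) ?B"
    by (simp add: lincomb_def)
  have "(D (c + 2 * r) ^^ p) (D (c + 2 * r) (lincomb 1 1 A ?B)) \<subseteq> (D (c + 2 * r) ^^ p) (lincomb 1 1 (D c A) ?B)"
    by (intro iter_mono sub weak_star_compact_lincomb compact_deriv B Suc.prems) simp
  also have "\<dots> = {}"
    using Suc.prems by (intro Suc.IH compact_deriv) (simp_all add: funpow_Suc_right del: funpow.simps)
  finally show ?case
    by (simp add: funpow_Suc_right del: funpow.simps)
qed

section \<open>Convex hulls: moving from the hull of \<open>A\<close> to the hull of its
  derivative\<close>

text \<open>The count \<open>Suc m\<close> is \<open>m\<close> derivations for the hull of
  \<open>D c A\<close> plus one for the remainder \<open>C\<close>; the loss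
  \<open>4 * R * d\<close> is twice the radius \<open>2 * R * d\<close> of the error ball.\<close>

lemma iter_slab:
  assumes A: "compactin weak_star A" and "0 < c" and ne: "D c A \<noteq> {}"
    and "c \<le> e" and Lempty: "(D e ^^ m) (wconv (D c A)) = {}"
    and R: "A \<subseteq> cball 0 R" and td: "0 \<le> t" "0 \<le> d" "t + d \<le> 1"
  shows "(D (e + 4 * R * d) ^^ Suc m) (lincomb t (1 - t) (wconv (D c A)) (wconv A))
    \<subseteq> lincomb (t + d) (1 - (t + d)) (wconv (D c A)) (wconv A)"
proof
  define L where "L = wconv (D c A)"
  define M where "M = wconv A"
  have A': "compactin weak_star (D c A)" by (rule compact_deriv[OF A])
  have L: "compactin weak_star L" "convex L" and M: "compactin weak_star M" "convex M"
    unfolding L_def M_def by (auto intro: weak_star_compact_wconv convex_wconv A A')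
  have LM: "L \<subseteq> M" unfolding L_def M_def by (intro wconv_mono deriv_subset)
  have MR: "M \<subseteq> cball 0 R"
    unfolding M_def by (intro wconv_minimal R weak_star_compact_closed weak_star_compact_cball) simp
  obtain a0 where a0: "a0 \<in> D c A" using ne by blast
  then have a0': "a0 \<in> L" "a0 \<in> A"
    using subset_wconv[of "D c A"] deriv_subset[of c A] by (auto simp: L_def)
  have normM: "norm y \<le> R" if "y \<in> M" for y
    using MR that by (auto simp: subset_iff)
  have "0 \<le> R" using normM[of a0] a0' LM norm_ge_zero[of a0] by (meson order_trans subsetD)
  let ?K = "\<lambda>t. lincomb t (1 - t) L M"
  fix x assume x: "x \<in> (D (e + 4 * R * d) ^^ Suc m) (lincomb t (1 - t) (wconv (D c A)) (wconv A))"
  show "x \<in> lincomb (t + d) (1 - (t + d)) (wconv (D c A)) (wconv A)"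
  proof (rule ccontr)
    assume "x \<notin> lincomb (t + d) (1 - (t + d)) (wconv (D c A)) (wconv A)"
    then have "x \<in> UNIV - ?K (t + d)" by (simp add: L_def M_def)
    moreover have "openin weak_star (UNIV - ?K (t + d))"
      using weak_star_compact_closed[OF weak_star_compact_lincomb[OF L(1) M(1)]] by (simp add: closedin_def)
    ultimately obtain F r0 where F: "finite F" "r0 > 0"
        "{y. \<forall>a\<in>F. \<bar>blinfun_apply y a - blinfun_apply x a\<bar> \<le> r0} \<subseteq> UNIV - ?K (t + d)"
      using weak_star_cylinder_base by blast
    \<comment> \<open>Half of \<open>r0\<close> allows for the distance from \<open>y\<close> to
      \<open>x\<close> on \<open>F\<close>, the other half for the shift by
      \<open>d *\<^sub>R z\<close>.\<close>
    define r where "r = r0 / 2"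
    have "r > 0" using F by (simp add: r_def)
    \<comment> \<open>Elements of \<open>M\<close> will be split between \<open>P\<close>, the part
      within \<open>r\<close> of \<open>L\<close> on \<open>F\<close>, and \<open>C\<close>, the
      hull of \<open>A\<close> outside \<open>U\<close>. The bound \<open>2 * R\<close> makes
      \<open>V\<close> compact and admits all differences of points of \<open>M\<close>; the point
      \<open>a0\<close> keeps \<open>C\<close> nonempty.\<close>
    define U where "U = (\<Union>l\<in>L. {y. \<forall>a\<in>F. \<bar>blinfun_apply y a - blinfun_apply l a\<bar> < r})"
    define V where "V = {v. \<forall>a\<in>F. \<bar>blinfun_apply v a - blinfun_apply 0 a\<bar> \<le> r} \<inter> cball (0 :: 'a \<Rightarrow>\<^sub>L real) (2 * R)"
    define P where "P = lincomb 1 1 L V \<inter> M"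
    define C where "C = wconv (A \<inter> (UNIV - U) \<union> {a0})"
    have "openin weak_star U"
      unfolding U_def using openin_weak_star_cylinder[OF F(1)] by (intro openin_Union) auto
    then have AU: "compactin weak_star (A \<inter> (UNIV - U))"
      using openin_closedin_eq[of weak_star U] by (intro weak_star_compact_Int_closed A) auto
    have V: "compactin weak_star V" "convex V"
    proof -
      have eq: "V = cball 0 (2 * R) \<inter> {v. \<forall>a\<in>F. \<bar>blinfun_apply v a - blinfun_apply 0 a\<bar> \<le> r}"
        by (auto simp: V_def)
      show "compactin weak_star V"
        unfolding eq by (intro weak_star_compact_Int_closed weak_star_compact_cball closedin_weak_star_cylinder)
      have "{v. \<forall>a\<in>F. \<bar>blinfun_apply v a - blinfun_apply 0 a\<bar> \<le> r}
          = (\<Inter>a\<in>F. (\<lambda>v. blinfun_apply v a) -` {-r..r})"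
        by (auto simp: abs_le_iff minus_le_iff)
      moreover have "convex ((\<lambda>v. blinfun_apply v a) -` {-r..r})" for a :: 'a
        by (intro convex_linear_vimage bounded_linear.linear) (auto simp: blinfun.bounded_linear_left)
      ultimately show "convex V"
        unfolding eq by (auto intro!: convex_Int convex_INT)
    qed
    have P: "compactin weak_star P" "convex P"
      unfolding P_def
      by (intro weak_star_compact_Int_closed weak_star_compact_lincomb weak_star_compact_closed L M V
          convex_Int convex_lincomb)+
    \<comment> \<open>\<open>U\<close> contains \<open>D c A\<close>, so what is left of
      \<open>A\<close> misses the derivative.\<close>
    have "\<eta> (A \<inter> (UNIV - U)) < c"
    proof (rule small_of_deriv_disjoint[OF A AU])
      have "L \<subseteq> U" unfolding U_def using \<open>r > 0\<close> by auto
      then show "A \<inter> (UNIV - U) \<inter> D c A = {}"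
        using subset_wconv[of "D c A"] by (auto simp: L_def)
    qed (use \<open>0 < c\<close> in auto)
    moreover have "\<eta> {a0} < c"
      using eta_singleton[of a0] \<open>0 < c\<close> by simp
    moreover have "compactin weak_star {a0}" by (simp add: weak_star_compact_finite)
    ultimately have "\<eta> (A \<inter> (UNIV - U) \<union> {a0}) < c"
      using eta_Un[OF AU, of "{a0}"] by simp
    moreover have AUa: "compactin weak_star (A \<inter> (UNIV - U) \<union> {a0})"
      by (intro compactin_Un AU weak_star_compact_finite) simp
    ultimately have "\<eta> C < e"
      using eta_wconv[OF AUa] \<open>c \<le> e\<close> unfolding C_def by simp
    have C: "compactin weak_star C" "convex C"
      unfolding C_def
      by (intro weak_star_compact_wconv AUa convex_wconv)+
    have CM: "C \<subseteq> M"
      unfolding C_def M_def using a0' by (intro wconv_mono) auto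
    have "M \<subseteq> segments P C"
      unfolding M_def
    proof (rule wconv_subset_segments[OF P(1) C(1) P(2) C(2)])
      have sub: "A \<subseteq> M" unfolding M_def by (rule subset_wconv)
      show "A \<subseteq> P \<union> C"
      proof
        fix y assume y: "y \<in> A"
        show "y \<in> P \<union> C"
        proof (cases "y \<in> U")
          case True
          then obtain l where l: "l \<in> L" "\<forall>a\<in>F. \<bar>blinfun_apply y a - blinfun_apply l a\<bar> < r"
            by (auto simp: U_def)
          have "y \<in> M" "l \<in> M"
            using subsetD[OF sub y] subsetD[OF LM l(1)] by simp_all
          have "norm (y - l) \<le> norm y + norm l" by (rule norm_triangle_ineq4)
          also have "\<dots> \<le> 2 * R"
            using normM[OF \<open>y \<in> M\<close>] normM[OF \<open>l \<in> M\<close>] by simp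
          finally have "y - l \<in> V"
            using l by (force simp: V_def blinfun.diff_left)
          moreover have "y = 1 *\<^sub>R l + 1 *\<^sub>R (y - l)" by simp
          ultimately have "y \<in> lincomb 1 1 L V"
            unfolding lincomb_def using l(1) by blast
          then show ?thesis using y sub by (auto simp: P_def)
        next
          case False
          then show ?thesis
            using y subset_wconv[of "A \<inter> (UNIV - U) \<union> {a0}"] by (auto simp: C_def)
        qed
      qed
      have "0 \<in> V" using \<open>r > 0\<close> \<open>0 \<le> R\<close> by (simp add: V_def)
      then have "1 *\<^sub>R a0 + 1 *\<^sub>R 0 \<in> lincomb 1 1 L V"
        unfolding lincomb_def using a0' by blast
      then show "P \<noteq> {}" using a0' sub by (auto simp: P_def)
      show "C \<noteq> {}" unfolding C_def using subset_wconv by blast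
    qed
    \<comment> \<open>The error ball absorbs the replacement of \<open>u\<close> by
      \<open>v\<close>: the mass moved is below \<open>d\<close>, and \<open>u - v\<close> has norm
      at most \<open>2 * R\<close>.\<close>
    let ?E = "lincomb 1 1 (lincomb t (1 - t) L C) (cball 0 (2 * R * d))"
    let ?W = "{y. \<forall>a\<in>F. \<bar>blinfun_apply y a - blinfun_apply x a\<bar> < r}"
    have "?K t \<inter> ?W \<subseteq> ?E"
    proof
      fix y assume y: "y \<in> ?K t \<inter> ?W"
      then obtain l k where lk: "l \<in> L" "k \<in> M" "y = t *\<^sub>R l + (1 - t) *\<^sub>R k"
        by (auto simp: lincomb_def)
      then obtain s u v where s: "0 \<le> s" "s \<le> 1" "u \<in> P" "v \<in> C" "k = s *\<^sub>R u + (1 - s) *\<^sub>R v"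
        using \<open>M \<subseteq> segments P C\<close> unfolding segments_def by blast
      have "u \<in> M" "v \<in> M" using s CM by (auto simp: P_def)
      \<comment> \<open>Otherwise, shifting mass \<open>d\<close> from \<open>u\<close> to its \<open>r\<close>-neighbour in \<open>L\<close> gives a point of \<open>?K (t + d)\<close> close to \<open>x\<close>.\<close>
      have "(1 - t) * s < d"
      proof (rule ccontr)
        assume "\<not> (1 - t) * s < d"
        then have ds: "d \<le> (1 - t) * s" by simp
        obtain l' z where z: "l' \<in> L" "z \<in> V" "u = l' + z"
          using s(3) unfolding P_def lincomb_def by auto
        obtain l'' where l'': "l'' \<in> L" "t *\<^sub>R l + d *\<^sub>R l' = (t + d) *\<^sub>R l''"
          using convex_nonneg_comb[OF L(2) lk(1) z(1) td(1,2)] .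
        obtain w where w: "w \<in> M" "((1 - t) * s - d) *\<^sub>R u + ((1 - t) * (1 - s)) *\<^sub>R v
            = (((1 - t) * s - d) + ((1 - t) * (1 - s))) *\<^sub>R w"
          using convex_nonneg_comb[OF M(2) \<open>u \<in> M\<close> \<open>v \<in> M\<close>, of "(1 - t) * s - d" "(1 - t) * (1 - s)"]
            ds s td by auto
        have "((1 - t) * s - d) + ((1 - t) * (1 - s)) = 1 - (t + d)"
          by (simp add: algebra_simps)
        note w2 = w(2)[unfolded this]
        have "y - d *\<^sub>R z = (t *\<^sub>R l + d *\<^sub>R l') + (((1 - t) * s - d) *\<^sub>R u + ((1 - t) * (1 - s)) *\<^sub>R v)"
          by (simp add: lk(3) s(5) z(3) algebra_simps)
        also have "\<dots> = (t + d) *\<^sub>R l'' + (1 - (t + d)) *\<^sub>R w"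
          by (simp only: l'' w2)
        finally have "y - d *\<^sub>R z \<in> ?K (t + d)"
          unfolding lincomb_def using l'' w by blast
        moreover have "\<bar>blinfun_apply (y - d *\<^sub>R z) a - blinfun_apply x a\<bar> \<le> r0" if "a \<in> F" for a
        proof -
          have "\<bar>blinfun_apply y a - blinfun_apply x a\<bar> < r" using y that by auto
          moreover have "\<bar>d * blinfun_apply z a\<bar> \<le> 1 * r"
            unfolding abs_mult using z(2) that td by (intro mult_mono) (auto simp: V_def)
          ultimately show ?thesis
            unfolding blinfun.diff_left blinfun.scaleR_left real_scaleR_def r_def by linarith
        qed
        ultimately show False using F(3) by blast
      qed
      have "norm (((1 - t) * s) *\<^sub>R (u - v)) \<le> d * (2 * R)"
      proof -
        have "norm (u - v) \<le> norm u + norm v" by (rule norm_triangle_ineq4)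
        also have "\<dots> \<le> 2 * R"
          using normM[OF \<open>u \<in> M\<close>] normM[OF \<open>v \<in> M\<close>] by simp
        finally show ?thesis
          using \<open>(1 - t) * s < d\<close> td s by (auto simp: abs_mult intro!: mult_mono)
      qed
      then have "((1 - t) * s) *\<^sub>R (u - v) \<in> cball 0 (2 * R * d)"
        by (simp add: mult.commute mult.left_commute)
      moreover have "t *\<^sub>R l + (1 - t) *\<^sub>R v \<in> lincomb t (1 - t) L C"
        unfolding lincomb_def using lk s by blast
      moreover have "y = 1 *\<^sub>R (t *\<^sub>R l + (1 - t) *\<^sub>R v) + 1 *\<^sub>R (((1 - t) * s) *\<^sub>R (u - v))"
        by (simp add: lk(3) s(5) algebra_simps)
      ultimately show "y \<in> ?E"
        unfolding lincomb_def[of 1 1] by blast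
    qed
    have E1: "compactin weak_star (lincomb t (1 - t) L C)"
      by (intro weak_star_compact_lincomb L C)
    \<comment> \<open>Locality transfers the iterated derivative at \<open>x\<close> to
      \<open>?E\<close>, although \<open>?K t\<close> is known to lie in \<open>?E\<close> only near
      \<open>x\<close>.\<close>
    have "x \<in> (D (e + 4 * R * d) ^^ Suc m) (?K t) \<inter> ?W"
      using x \<open>r > 0\<close> unfolding L_def M_def by (auto simp del: funpow.simps)
    also have "\<dots> \<subseteq> (D (e + 4 * R * d) ^^ Suc m) ?E"
      by (intro iter_local \<open>?K t \<inter> ?W \<subseteq> ?E\<close> openin_weak_star_cylinder F weak_star_compact_lincomb L M C
          weak_star_compact_cball) simp
    also have "\<dots> = {}"
    proof -
      have "(D e ^^ 1) C = {}"
        using deriv_empty_of_small[OF C(1) \<open>\<eta> C < e\<close>] by simp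
      then have "(D e ^^ (m + 1)) (lincomb t (1 - t) L C) = {}"
        using \<open>0 < c\<close> \<open>c \<le> e\<close> td Lempty unfolding L_def[symmetric]
        by (intro iter_lincomb_empty L C) auto
      then have "(D (e + 2 * (2 * R * d)) ^^ (m + 1)) ?E = {}"
        using \<open>0 < c\<close> \<open>c \<le> e\<close> \<open>0 \<le> R\<close> td by (intro iter_cball_empty E1) auto
      then show ?thesis by (simp add: mult.assoc del: funpow.simps)
    qed
    finally show False by simp
  qed
qed

text \<open>Induction on \<open>k\<close> with an arbitrarily small loss in the threshold at each
  level. The number of derivations may grow, which the omega-iterated measure does not see.\<close>

lemma iter_wconv_empty:
  assumes "compactin weak_star A" "0 < c" "(D c ^^ k) A = {}" "c < c'"
  obtains m where "(D c' ^^ m) (wconv A) = {}"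
proof -
  have "\<exists>m. (D c' ^^ m) (wconv A) = {}"
    using assms(1,3,4)
  proof (induction k arbitrary: A c')
    case 0
    then have "wconv A = {}" by (simp add: wconv_def)
    then show ?case by (metis iter_empty)
  next
    case (Suc k)
    note A = Suc.prems(1)
    let ?L = "wconv (D c A)" and ?M = "wconv A"
    have M: "compactin weak_star ?M" by (rule weak_star_compact_wconv[OF A])
    have L: "compactin weak_star ?L" by (intro weak_star_compact_wconv compact_deriv A)
    show ?case
    proof (cases "D c A = {}")
      \<comment> \<open>One derivation exhausts \<open>A\<close>, so \<open>\<eta> A\<close> is
        below \<open>c\<close> and one derivation exhausts the hull too.\<close>
      case True
      then have "\<eta> A < c"
        using small_of_deriv_disjoint[OF A A] \<open>0 < c\<close> by simp
      then have "\<eta> ?M < c'"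
        using eta_wconv[OF A] \<open>c < c'\<close> by simp
      then have "(D c' ^^ 1) ?M = {}"
        using deriv_empty_of_small[OF M] by simp
      then show ?thesis by blast
    next
      case False
      \<comment> \<open>The gap from \<open>c\<close> to \<open>e\<close> pays for the induction
        hypothesis, the gap from \<open>e\<close> to \<open>c'\<close> for the error
        \<open>4 * R * d\<close> of a slab.\<close>
      define e where "e = (c + c') / 2"
      have "c < e" "e < c'" using Suc.prems by (auto simp: e_def)
      obtain m where m: "(D e ^^ m) ?L = {}"
        using Suc.IH[of "D c A" e] Suc.prems \<open>c < e\<close>
        by (auto simp: compact_deriv funpow_Suc_right simp del: funpow.simps)
      obtain R where R: "R > 0" "A \<subseteq> cball 0 R" using weak_star_compact_bounded[OF A] .
      \<comment> \<open>\<open>N\<close> slabs of width \<open>1 / N\<close> lead from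
        \<open>?M\<close> to \<open>?L\<close>. Each loss \<open>4 * R / N\<close> is measured
        against the same threshold \<open>c'\<close>, so the losses do not add up.\<close>
      obtain N :: nat where "4 * R / (c' - e) < real N"
        using reals_Archimedean2 by blast
      moreover from this have "N > 0"
        using R(1) \<open>e < c'\<close> by (cases "N = 0") (auto simp: divide_less_0_iff)
      ultimately have N: "N > 0" "4 * R / real N < c' - e"
        using \<open>e < c'\<close> by (auto simp: field_simps)
      define d where "d = 1 / real N"
      have "e + 4 * R * d \<le> c'" using N by (simp add: d_def)
      have step: "(D c' ^^ (Suc m * j)) ?M \<subseteq> lincomb (real j * d) (1 - real j * d) ?L ?M" if "j \<le> N" for j
        using that
      proof (induction j)
        case 0
        have "?L \<noteq> {}" using False subset_wconv by blast
        then show ?case by (auto simp: lincomb_def)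
      next
        case (Suc j)
        have "real (Suc j) \<le> real N" using Suc.prems by simp
        then have jd: "real j * d + d \<le> 1"
          using N by (simp add: d_def field_simps)
        have comp: "compactin weak_star (lincomb (real j * d) (1 - real j * d) ?L ?M)"
          by (intro weak_star_compact_lincomb L M)
        have "(D c' ^^ (Suc m * Suc j)) ?M = (D c' ^^ Suc m) ((D c' ^^ (Suc m * j)) ?M)"
          by (metis comp_apply funpow_add mult_Suc_right)
        also have "\<dots> \<subseteq> (D (e + 4 * R * d) ^^ Suc m) (lincomb (real j * d) (1 - real j * d) ?L ?M)"
          using Suc by (intro iter_mono compact_iter M comp \<open>e + 4 * R * d \<le> c'\<close>) simp
        also have "\<dots> \<subseteq> lincomb (real j * d + d) (1 - (real j * d + d)) ?L ?M"
          using \<open>c < e\<close> jd by (intro iter_slab A \<open>0 < c\<close> False m R) (auto simp: d_def)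
        also have "real j * d + d = real (Suc j) * d" by (simp add: algebra_simps)
        finally show ?case .
      qed
      \<comment> \<open>At \<open>j = N\<close> the weight of \<open>?L\<close> is 1;
        \<open>m\<close> further derivations exhaust \<open>?L\<close>.\<close>
      have "lincomb (real N * d) (1 - real N * d) ?L ?M \<subseteq> ?L"
        using N by (auto simp: d_def lincomb_def)
      then have "(D c' ^^ (Suc m * N)) ?M \<subseteq> ?L"
        using step[of N] by blast
      then have "(D c' ^^ m) ((D c' ^^ (Suc m * N)) ?M) \<subseteq> (D e ^^ m) ?L"
        using \<open>e < c'\<close> by (intro iter_mono compact_iter M L) auto
      then have "(D c' ^^ (m + Suc m * N)) ?M = {}"
        using m by (simp add: funpow_add)
      then show ?thesis by blast
    qed
  qed
  then show thesis using that by blast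
qed

section \<open>Passage to the omega-iterated measure\<close>

text \<open>Cantor's intersection theorem: the iterates are decreasing closed subsets of the compact
  set \<open>A\<close>, so an empty intersection is reached at a finite stage.\<close>

lemma deriv_omega_empty_iff:
  assumes "compactin weak_star A"
  shows "fragment_deriv_omega \<eta> c A = {} \<longleftrightarrow> (\<exists>k. (D c ^^ k) A = {})"
proof
  assume empty: "fragment_deriv_omega \<eta> c A = {}"
  show "\<exists>k. (D c ^^ k) A = {}"
  proof (rule ccontr)
    assume "\<not> ?thesis"
    then have ne: "(D c ^^ k) A \<noteq> {}" for k by blast
    have "closedin (subtopology weak_star A) ((D c ^^ k) A)" for k
      using closedin_subset_topspace[OF weak_star_compact_closed[OF compact_iter[OF assms]] iter_subset] .
    then have "(\<Inter>k. (D c ^^ k) A) \<noteq> {}"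
      using assms ne iter_decreasing
      by (intro compact_space_imp_nest[of "subtopology weak_star A"])
        (auto simp: compactin_subspace decseq_def)
    then show False
      using empty by (simp add: fragment_deriv_omega_def)
  qed
qed (auto simp: fragment_deriv_omega_def)

lemma omega_measure_less:
  assumes A: "compactin weak_star A" and "omega_measure \<eta> A < c"
  shows "0 < c" "\<exists>k. (D c ^^ k) A = {}"
proof -
  let ?S = "{\<epsilon>. \<epsilon> > 0 \<and> fragment_deriv_omega \<eta> \<epsilon> A = {}}"
  \<comment> \<open>This makes the set of admissible thresholds nonempty. The maximum with 0 keeps
    the witness positive should \<open>\<eta> A\<close> be negative.\<close>
  have "(D (max (\<eta> A) 0 + 1) ^^ 1) A = {}"
    using deriv_empty_of_small[OF A, of "max (\<eta> A) 0 + 1"] by simp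
  then have "fragment_deriv_omega \<eta> (max (\<eta> A) 0 + 1) A = {}"
    using deriv_omega_empty_iff[OF A] by blast
  then have "max (\<eta> A) 0 + 1 \<in> ?S"
    by (simp add: add_nonneg_pos)
  then obtain e where "e \<in> ?S" "e < c"
    using cInf_lessD[of ?S c] assms(2) unfolding omega_measure_def by blast
  then obtain k where e: "0 < e" "(D e ^^ k) A = {}"
    using deriv_omega_empty_iff[OF A] by auto
  then show "0 < c" using \<open>e < c\<close> by simp
  show "\<exists>k. (D c ^^ k) A = {}"
    using iter_mono[OF A A, of e c k] e \<open>e < c\<close> by auto
qed

lemma omega_measure_le:
  assumes "compactin weak_star A" "0 < c" "(D c ^^ k) A = {}"
  shows "omega_measure \<eta> A \<le> c"
  unfolding omega_measure_def
  by (rule cInf_lower) (use assms in \<open>auto simp: deriv_omega_empty_iff intro: bdd_belowI[of _ 0]\<close>)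

text \<open>Every inequality is tested with thresholds \<open>c\<close> above its right-hand side,
  where it becomes a statement that finitely many derivations exhaust a set.\<close>

lemma convex_mnc_omega_measure: "convex_mnc (omega_measure \<eta>)"
proof
  fix A B :: "('a \<Rightarrow>\<^sub>L real) set" assume A: "compactin weak_star A"
  show "omega_measure \<eta> (wconv A) \<le> omega_measure \<eta> A"
  proof (rule dense_ge)
    fix c assume c: "omega_measure \<eta> A < c"
    \<comment> \<open>This leaves room below \<open>c\<close> for the strict loss in
      \<open>iter_wconv_empty\<close>.\<close>
    define e where "e = (omega_measure \<eta> A + c) / 2"
    have e: "omega_measure \<eta> A < e" "e < c" using c by (auto simp: e_def)
    obtain k where k: "0 < e" "(D e ^^ k) A = {}"
      using omega_measure_less[OF A e(1)] by blast
    obtain m where "(D c ^^ m) (wconv A) = {}"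
      using iter_wconv_empty[OF A k e(2)] .
    then show "omega_measure \<eta> (wconv A) \<le> c"
      using k e by (intro omega_measure_le weak_star_compact_wconv A) auto
  qed
  show "omega_measure \<eta> (lincomb 1 1 A (cball 0 r)) \<le> omega_measure \<eta> A + 2 * r" if "0 \<le> r" for r
  proof (rule dense_ge)
    fix c assume "omega_measure \<eta> A + 2 * r < c"
    then have "omega_measure \<eta> A < c - 2 * r" by simp
    then obtain k where k: "0 < c - 2 * r" "(D (c - 2 * r) ^^ k) A = {}"
      using omega_measure_less[OF A] by blast
    then have "(D c ^^ k) (lincomb 1 1 A (cball 0 r)) = {}"
      using iter_cball_empty[OF k(1) that A k(2)] by simp
    then show "omega_measure \<eta> (lincomb 1 1 A (cball 0 r)) \<le> c"
      using k that by (intro omega_measure_le weak_star_compact_lincomb A weak_star_compact_cball) auto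
  qed
  assume B: "compactin weak_star B"
  show "omega_measure \<eta> A \<le> omega_measure \<eta> B" if "A \<subseteq> B"
  proof (rule dense_ge)
    fix c assume "omega_measure \<eta> B < c"
    then obtain k where k: "0 < c" "(D c ^^ k) B = {}"
      using omega_measure_less[OF B] by blast
    then show "omega_measure \<eta> A \<le> c"
      using iter_mono[OF A B that, of c c k] by (intro omega_measure_le[OF A, of _ k]) auto
  qed
  have common: "\<exists>k l. 0 < c \<and> (D c ^^ k) A = {} \<and> (D c ^^ l) B = {}"
    if "max (omega_measure \<eta> A) (omega_measure \<eta> B) < c" for c
    using omega_measure_less[OF A, of c] omega_measure_less[OF B, of c] that by auto
  show "omega_measure \<eta> (A \<union> B) \<le> max (omega_measure \<eta> A) (omega_measure \<eta> B)"
  proof (rule dense_ge)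
    fix c assume "max (omega_measure \<eta> A) (omega_measure \<eta> B) < c"
    then obtain k l where *: "0 < c" "(D c ^^ k) A = {}" "(D c ^^ l) B = {}"
      using common by blast
    have "(D c ^^ max k l) A = {}" "(D c ^^ max k l) B = {}"
      using * iter_decreasing[of k "max k l" c A] iter_decreasing[of l "max k l" c B] by auto
    then have "(D c ^^ max k l) (A \<union> B) = {}"
      using iter_Un[OF A B, of "max k l" c] by auto
    then show "omega_measure \<eta> (A \<union> B) \<le> c"
      by (rule omega_measure_le[OF compactin_Un[OF A B] *(1)])
  qed
  show "omega_measure \<eta> (lincomb t (1 - t) A B) \<le> max (omega_measure \<eta> A) (omega_measure \<eta> B)"
    if "0 \<le> t" "t \<le> 1" for t
  proof (rule dense_ge)
    fix c assume "max (omega_measure \<eta> A) (omega_measure \<eta> B) < c"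
    then obtain k l where *: "0 < c" "(D c ^^ k) A = {}" "(D c ^^ l) B = {}"
      using common by blast
    show "omega_measure \<eta> (lincomb t (1 - t) A B) \<le> c"
      by (rule omega_measure_le[OF weak_star_compact_lincomb[OF A B] *(1) iter_lincomb_empty[OF *(1) that A B *(2,3)]])
  qed
next
  fix x :: "'a \<Rightarrow>\<^sub>L real"
  have x: "compactin weak_star {x}" by (simp add: weak_star_compact_finite)
  show "omega_measure \<eta> {x} \<le> 0"
  proof (rule dense_ge)
    fix c :: real assume "0 < c"
    then have "(D c ^^ 1) {x} = {}"
      using deriv_empty_of_small[OF x, of c] eta_singleton[of x] by simp
    then show "omega_measure \<eta> {x} \<le> c"
      by (rule omega_measure_le[OF x \<open>0 < c\<close>])
  qed
qed

end

subsection \<open>The Kuratowski measure\<close>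

lemma kuratowski_less:
  assumes "bounded A" "kuratowski A < c"
  obtains C where "0 < c" "finite C" "A \<subseteq> (\<Union>x\<in>C. cball x (c / 2))"
proof -
  let ?S = "{\<epsilon>. \<epsilon> > 0 \<and> (\<exists>C. finite C \<and> A \<subseteq> (\<Union>c\<in>C. cball c (\<epsilon> / 2)))}"
  obtain R where R: "R > 0" "A \<subseteq> cball 0 R"
    using assms(1) unfolding bounded_pos by (auto simp: subset_iff)
  \<comment> \<open>A single ball around 0 shows that the infimum is taken over a nonempty
    set.\<close>
  then have "finite {0::'a \<Rightarrow>\<^sub>L real} \<and> A \<subseteq> (\<Union>c\<in>{0}. cball c (2 * R / 2))"
    by simp
  then have "2 * R \<in> ?S"
    using R(1) by (intro CollectI conjI exI[of _ "{0}"]) auto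
  then obtain e where "e \<in> ?S" "e < c"
    using cInf_lessD[of ?S c] assms(2) unfolding kuratowski_def by blast
  then obtain C where C: "0 < e" "finite C" "A \<subseteq> (\<Union>x\<in>C. cball x (e / 2))" by blast
  have "(\<Union>x\<in>C. cball x (e / 2)) \<subseteq> (\<Union>x\<in>C. cball x (c / 2))"
    using \<open>e < c\<close> by (intro UN_mono subset_cball) auto
  with C(3) have "A \<subseteq> (\<Union>x\<in>C. cball x (c / 2))"
    by (rule order_trans)
  then show thesis using that C \<open>e < c\<close> by simp
qed

lemma kuratowski_le:
  assumes "0 < c" "finite C" "A \<subseteq> (\<Union>x\<in>C. cball x (c / 2))"
  shows "kuratowski A \<le> c"
  unfolding kuratowski_def
  by (rule cInf_lower) (use assms in \<open>auto intro: bdd_belowI[of _ 0]\<close>)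

lemma bounded_of_weak_star_compact:
  fixes A :: "('a::banach \<Rightarrow>\<^sub>L real) set"
  shows "compactin weak_star A \<Longrightarrow> bounded A"
  by (metis weak_star_compact_bounded bounded_cball bounded_subset)

text \<open>The hull \<open>?H\<close> of the centres is norm compact, hence weak-star compact, so
  \<open>?H\<close> plus a ball is a weak-star closed convex set containing \<open>A\<close>. A
  finite net of \<open>?H\<close> then gives the cover.\<close>

lemma kuratowski_wconv_le:
  fixes A :: "('a::banach \<Rightarrow>\<^sub>L real) set"
  assumes A: "compactin weak_star A"
  shows "kuratowski (wconv A) \<le> kuratowski A"
proof (rule dense_ge)
  fix c assume c: "kuratowski A < c"
  define e where "e = (kuratowski A + c) / 2"
  have e: "kuratowski A < e" "e < c" using c by (auto simp: e_def)
  obtain C where C: "0 < e" "finite C" "A \<subseteq> (\<Union>x\<in>C. cball x (e / 2))"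
    using kuratowski_less[OF bounded_of_weak_star_compact[OF A] e(1)] .
  let ?H = "convex hull C"
  have H: "compact ?H" by (rule finite_imp_compact_convex_hull[OF C(2)])
  have sub: "wconv A \<subseteq> lincomb 1 1 ?H (cball 0 (e / 2))"
  proof (rule wconv_minimal)
    show "A \<subseteq> lincomb 1 1 ?H (cball 0 (e / 2))"
    proof
      fix x assume "x \<in> A"
      then obtain y where y: "y \<in> C" "x \<in> cball y (e / 2)" using C(3) by blast
      have "x = 1 *\<^sub>R y + 1 *\<^sub>R (x - y)" "x - y \<in> cball 0 (e / 2)"
        using y by (auto simp: dist_norm norm_minus_commute)
      then show "x \<in> lincomb 1 1 ?H (cball 0 (e / 2))"
        unfolding lincomb_def using hull_inc[OF y(1), of convex] by blast
    qed
  qed (intro convex_lincomb weak_star_compact_closed weak_star_compact_lincomb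
      compactin_weak_star_of_compact H weak_star_compact_cball convex_convex_hull convex_cball)+
  \<comment> \<open>The radii add up to \<open>(c - e) / 2 + e / 2 = c / 2\<close>.\<close>
  have "0 < (c - e) / 2" using e by simp
  then obtain K where K: "finite K" "K \<subseteq> ?H" "?H \<subseteq> (\<Union>x\<in>K. ball x ((c - e) / 2))"
    using compactE_image[OF H, of ?H "\<lambda>x. ball x ((c - e) / 2)"] by force
  show "kuratowski (wconv A) \<le> c"
  proof (rule kuratowski_le[OF _ K(1)])
    show "0 < c" using C e by simp
    show "wconv A \<subseteq> (\<Union>x\<in>K. cball x (c / 2))"
    proof
      fix x assume "x \<in> wconv A"
      then obtain h b where h: "h \<in> ?H" "norm b \<le> e / 2" "x = h + b"
        using sub by (auto simp: lincomb_def)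
      then obtain k where k: "k \<in> K" "dist k h < (c - e) / 2" using K(3) by auto
      have "dist k x \<le> dist k h + dist h x" by (rule dist_triangle)
      also have "\<dots> \<le> c / 2" using k h by (simp add: dist_norm field_simps)
      finally show "x \<in> (\<Union>x\<in>K. cball x (c / 2))" using k by auto
    qed
  qed
qed

lemma convex_mnc_kuratowski: "convex_mnc (kuratowski :: ('a::banach \<Rightarrow>\<^sub>L real) set \<Rightarrow> real)"
proof
  fix A B :: "('a \<Rightarrow>\<^sub>L real) set" assume A: "compactin weak_star A"
  note bA = bounded_of_weak_star_compact[OF A]
  show "kuratowski (wconv A) \<le> kuratowski A" by (rule kuratowski_wconv_le[OF A])
  show "kuratowski (lincomb 1 1 A (cball 0 r)) \<le> kuratowski A + 2 * r" if "0 \<le> r" for r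
  proof (rule dense_ge)
    fix c assume "kuratowski A + 2 * r < c"
    then have "kuratowski A < c - 2 * r" by simp
    then obtain C where C: "0 < c - 2 * r" "finite C" "A \<subseteq> (\<Union>x\<in>C. cball x ((c - 2 * r) / 2))"
      using kuratowski_less[OF bA] by blast
    \<comment> \<open>The same centres serve with the radius enlarged by \<open>r\<close>, since
      \<open>(c - 2 * r) / 2 + r = c / 2\<close>.\<close>
    show "kuratowski (lincomb 1 1 A (cball 0 r)) \<le> c"
    proof (rule kuratowski_le[OF _ C(2)])
      show "lincomb 1 1 A (cball 0 r) \<subseteq> (\<Union>x\<in>C. cball x (c / 2))"
      proof
        fix x assume "x \<in> lincomb 1 1 A (cball 0 r)"
        then obtain a b where ab: "a \<in> A" "norm b \<le> r" "x = a + b" by (auto simp: lincomb_def)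
        then obtain k where k: "k \<in> C" "dist k a \<le> (c - 2 * r) / 2" using C(3) by auto
        have "dist k x \<le> dist k a + dist a x" by (rule dist_triangle)
        also have "\<dots> \<le> c / 2" using k ab by (simp add: dist_norm field_simps)
        finally show "x \<in> (\<Union>x\<in>C. cball x (c / 2))" using k by auto
      qed
    qed (use C that in simp)
  qed
  assume B: "compactin weak_star B"
  note bB = bounded_of_weak_star_compact[OF B]
  show "kuratowski A \<le> kuratowski B" if "A \<subseteq> B"
  proof (rule dense_ge)
    fix c assume "kuratowski B < c"
    then obtain C where "0 < c" "finite C" "B \<subseteq> (\<Union>x\<in>C. cball x (c / 2))"
      using kuratowski_less[OF bB] by blast
    then show "kuratowski A \<le> c"
      using that by (intro kuratowski_le) auto
  qed
  show "kuratowski (A \<union> B) \<le> max (kuratowski A) (kuratowski B)"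
  proof (rule dense_ge)
    fix c assume c: "max (kuratowski A) (kuratowski B) < c"
    have less: "kuratowski A < c" "kuratowski B < c" using c by simp_all
    obtain C where C: "0 < c" "finite C" "A \<subseteq> (\<Union>x\<in>C. cball x (c / 2))"
      using kuratowski_less[OF bA less(1)] .
    obtain C' where C': "0 < c" "finite C'" "B \<subseteq> (\<Union>x\<in>C'. cball x (c / 2))"
      using kuratowski_less[OF bB less(2)] .
    show "kuratowski (A \<union> B) \<le> c"
      by (rule kuratowski_le[of _ "C \<union> C'"]) (use C(1,2) C'(2) Un_mono[OF C(3) C'(3)] in \<open>simp_all add: UN_Un\<close>)
  qed
  show "kuratowski (lincomb t (1 - t) A B) \<le> max (kuratowski A) (kuratowski B)" if t: "0 \<le> t" "t \<le> 1" for t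
  proof (rule dense_ge)
    fix c assume c: "max (kuratowski A) (kuratowski B) < c"
    have less: "kuratowski A < c" "kuratowski B < c" using c by simp_all
    obtain C where C: "0 < c" "finite C" "A \<subseteq> (\<Union>x\<in>C. cball x (c / 2))"
      using kuratowski_less[OF bA less(1)] .
    obtain C' where C': "0 < c" "finite C'" "B \<subseteq> (\<Union>x\<in>C'. cball x (c / 2))"
      using kuratowski_less[OF bB less(2)] .
    \<comment> \<open>Centres are combined with the same weights as the points, so the error is an
      average of two errors of at most \<open>c / 2\<close>.\<close>
    show "kuratowski (lincomb t (1 - t) A B) \<le> c"
    proof (rule kuratowski_le[OF C(1)])
      show "finite (lincomb t (1 - t) C C')"
        unfolding lincomb_image using C C' by simp
      show "lincomb t (1 - t) A B \<subseteq> (\<Union>x\<in>lincomb t (1 - t) C C'. cball x (c / 2))"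
      proof
        fix x assume "x \<in> lincomb t (1 - t) A B"
        then obtain a b where ab: "a \<in> A" "b \<in> B" "x = t *\<^sub>R a + (1 - t) *\<^sub>R b"
          by (auto simp: lincomb_def)
        obtain k where k: "k \<in> C" "dist k a \<le> c / 2"
          using subsetD[OF C(3) ab(1)] by auto
        obtain l where l: "l \<in> C'" "dist l b \<le> c / 2"
          using subsetD[OF C'(3) ab(2)] by auto
        note kl = k l
        let ?y = "t *\<^sub>R k + (1 - t) *\<^sub>R l"
        have "?y - x = t *\<^sub>R (k - a) + (1 - t) *\<^sub>R (l - b)"
          by (simp add: ab algebra_simps)
        then have "dist ?y x \<le> norm (t *\<^sub>R (k - a)) + norm ((1 - t) *\<^sub>R (l - b))"
          unfolding dist_norm by (metis norm_triangle_ineq)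
        also have "\<dots> = t * dist k a + (1 - t) * dist l b"
          using t by (simp add: dist_norm)
        also have "\<dots> \<le> t * (c / 2) + (1 - t) * (c / 2)"
          using kl t by (intro add_mono mult_left_mono) auto
        also have "\<dots> = c / 2" by (simp add: field_simps)
        finally have "x \<in> cball ?y (c / 2)" by simp
        moreover have "?y \<in> lincomb t (1 - t) C C'"
          unfolding lincomb_def using kl by blast
        ultimately show "x \<in> (\<Union>x\<in>lincomb t (1 - t) C C'. cball x (c / 2))" by blast
      qed
    qed
  qed
next
  fix x :: "'a \<Rightarrow>\<^sub>L real"
  show "kuratowski {x} \<le> 0"
    by (rule dense_ge, rule kuratowski_le[of _ "{x}"]) auto
qed

section \<open>Induction on the exponent and the convexifiability constant\<close>

lemma convex_mnc_kuratowski_omega: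
  "convex_mnc (kuratowski_omega n :: ('a::banach \<Rightarrow>\<^sub>L real) set \<Rightarrow> real)"
  by (induction n) (simp_all add: convex_mnc_kuratowski convex_mnc.convex_mnc_omega_measure)

theorem theorem5p9:
  fixes n :: nat
  assumes "separable_space (euclidean :: 'a::banach topology)"
  shows "convexifiable (kuratowski_omega n :: ('a \<Rightarrow>\<^sub>L real) set \<Rightarrow> real)"
proof -
  interpret convex_mnc "kuratowski_omega n :: ('a \<Rightarrow>\<^sub>L real) set \<Rightarrow> real"
    by (rule convex_mnc_kuratowski_omega)
  show ?thesis
    unfolding convexifiable_def using eta_wconv by (intro exI[of _ 1]) (simp add: wconv_def)
qed

end
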